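(* Let $P$ be a $d$-complete (locally finite) poset. (a) The poset $P$ satisfies all of the axioms (VT), (FT), (NCC), and, for every $k\ge 3$, (D$k^-$C), (D$k$MF), (D$k^-$CF), (NOD$k^-$), (D$k$MD), and it possesses the properties (UPUE), (DAI), (UT), and (UC$k$) for every $k\ge 3$. (b) If $P$ is finite, it also possesses the properties (CLE), (SS), (NTC), ranked, and, for every $k\geq 3$, (YECOI) and (N$\Lambda$Y$k$); and if moreover $P$ is connected, it also possesses (UM) and (CLMEE).
   Context: All posets are locally finite (every closed interval is finite). Write $x\rightarrow y$ when $y$ covers $x$; $\{x,y\}\rightarrow z$ means $x\to z$ and $y\to z$; $w\to\{x,y\}$ means $w\to x$ and $w\to y$. A chain is a sequence $x_1\to x_2\to\cdots\to x_n$, $n\ge1$, of length $n-1$. A rank function is $\rho:P\to\mathbb Z$ such that $x\to y$ implies $\rho(y)=\rho(x)+1$; $P$ is ranked if it has one. $P$ is connected if its Hasse diagram is connected (and nonempty). For $k\ge 3$, $d_k(1)$ is the $(2k-2)$-element poset $\{a_k,\dots,a_3;b,c;f_3,\dots,f_k\}$ with covering relations $a_k\to\cdots\to a_3\to\{b,c\}\to f_3\to\cdots\to f_k$. An interval is a $d_k$-interval if it is isomorphic to $d_k(1)$. A convex subset is a $d_k^-$-set if it is isomorphic to $d_k(1)-\{f_k\}$; for $k=3$ this is a vee, i.e. a set $\{w;x,y\}$ of distinct elements with $w\to\{x,y\}$. For $k\ge4$ a $d_k^-$-set is an interval (a $d_k^-$-interval). A completing element of a $d_k^-$-set $S$ is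 an element $z$ such that $S\cup\{z\}$ is a $d_k$-interval (with maximum $z$). Two $d_3^-$-sets $\{w;x,y\}$, $\{w';x,y\}$ with $w\ne w'$ overlap. For $k\ge4$, if $[w,z']$ is a $d_k^-$-interval in which $u$ is the unique element covering $w$, and $w'\ne w$ is covered by $u$ and $[w',z']$ is also a $d_k^-$-interval, these two overlap. $d_k$-intervals are distinct if they differ as sets. A diamond is a set $\{w;x,y;z\}$ of distinct elements with $w\to\{x,y\}$ and $\{x,y\}\to z$; its top is $z$ and its elbows are $x,y$. A top of a vee $\{w;x,y\}$ is an element $z$ with $\{x,y\}\to z$. An interval $[w,z]$ is short if there is $u$ with $w\to u\to z$. Put $[w;x,y]=[w,x]\cup[w,y]$ and $[u,v;x,y]=[u;x,y]\cup[v;x,y]$. A $Y_k$-set is a convex set $[w;x,y]$ isomorphic to $[a_k;b,c]\subseteq d_k(1)$, so its elements are $w=w_k\to w_{k-1}\to\cdots\to w_3\to\{x,y\}$; $w_k,\dots,w_3$ are its stem elements. A $\Lambda Y_k$-set is a convex set $[u,v;x,y]$ with $u\neq v$, $\{u,v\}\to w_k$ and $[u,v;x,y]=\{u,v\}\cup[w_k;x,y]$ where $[w_k;x,y]$ is a $Y_k$-set. A poset is $d_k$-complete if for every $d_k^-$-set $S$ there exists an element that covers exactly the maximal element(s) of $S$ and that does not cover the maximal element (when $k=3$: both of the maximal elements) of any other $d_k^-$-set. It is $d$-complete if it is $d_k$-complete for every $k\ge3$. Axioms: (VT) $w\to\{x,y\}$ (with $x\ne y$) implies there is $z$ with $\{x,y\}\to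 z$. (FT) the top of each diamond covers only the elbows of the diamond. (NCC) there do not exist overlapping $d_3^-$-sets. (D$k^-$C) for each $d_k^-$-set $S$ there is $z$ such that $S\cup\{z\}$ is a $d_k$-interval. (D$k$MF) the maximum element of each $d_k$-interval covers only elements in that interval. (D$k^-$CF) for each $d_k^-$-set $S$ there is $z$ such that $S\cup\{z\}$ is a $d_k$-interval with maximum $z$ and $z$ covers only elements of $S$. (NOD$k^-$) there do not exist overlapping $d_k^-$-sets. (D$k$MD) the maximum elements of distinct $d_k$-intervals are distinct. Properties: (UPUE) $w\le y$, $w\to x$, $x\not\le y$ imply there is $z$ with $y\to z$ and $x\le z$. (UM) there is a unique maximal element. (CLMEE) (UM) holds and for each element $w$ every chain from $w$ to the unique maximal element has the same length. (CLE) whenever $x<y$, all chains from $x$ to $y$ have equal length. (SS) whenever $[w,z]$ is a short interval, $|[w,z]|\in\{3,4\}$. (DAI) each diamond $\{w;x,y;z\}$ is an interval, i.e. equals $[w,z]$. (NTC) no element is covered by three (distinct) elements. (UT) each vee has exactly one top. (UC$k$) each $d_k^-$-set has exactly one completing element. (YECOI), for given $k$: each stem element of a $Y_k$-set is covered only by elements of that set. (N$\Lambda$Y$k$) there are no $\Lambda Y_k$-sets. *)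

theory Defs
  imports Main
begin

text \<open>
  A poset is a set \<open>P\<close> of elements of some type of class \<open>order\<close>, with the induced order; in
  particular \<open>P\<close> may be empty, and covering relations and intervals are taken relative to \<open>P\<close>.
\<close>

section \<open>Covers, intervals, chains, ranks\<close>

text \<open>\<open>covby P x y\<close> is \<open>x \<rightarrow> y\<close>: the element \<open>y\<close> covers \<open>x\<close> in \<open>P\<close>.\<close>

definition covby :: "'a::order set \<Rightarrow> 'a \<Rightarrow> 'a \<Rightarrow> bool" where
  "covby P x y \<longleftrightarrow> x \<in> P \<and> y \<in> P \<and> x < y \<and> \<not> (\<exists>z\<in>P. x < z \<and> z < y)"

definition itv :: "'a::order set \<Rightarrow> 'a \<Rightarrow> 'a \<Rightarrow> 'a set" where
  "itv P x y = {x..y} \<inter> P"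

definition locally_finite :: "'a::order set \<Rightarrow> bool" where
  "locally_finite P \<longleftrightarrow> (\<forall>x\<in>P. \<forall>y\<in>P. finite (itv P x y))"

definition is_interval :: "'a::order set \<Rightarrow> 'a set \<Rightarrow> bool" where
  "is_interval P S \<longleftrightarrow> (\<exists>x\<in>P. \<exists>y\<in>P. x \<le> y \<and> S = itv P x y)"

definition convex_in :: "'a::order set \<Rightarrow> 'a set \<Rightarrow> bool" where
  "convex_in P S \<longleftrightarrow> S \<subseteq> P \<and> (\<forall>x\<in>S. \<forall>y\<in>S. itv P x y \<subseteq> S)"

definition maximals :: "'a::order set \<Rightarrow> 'a set" where
  "maximals S = {m \<in> S. \<not> (\<exists>s\<in>S. m < s)}"

definition is_maximum :: "'a::order set \<Rightarrow> 'a \<Rightarrow> bool" where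
  "is_maximum S m \<longleftrightarrow> m \<in> S \<and> (\<forall>s\<in>S. s \<le> m)"

text \<open>The chain \<open>x\<^sub>1 \<rightarrow> \<dots> \<rightarrow> x\<^sub>n\<close> is the list of its elements.\<close>

definition cover_chain :: "'a::order set \<Rightarrow> 'a list \<Rightarrow> bool" where
  "cover_chain P xs \<longleftrightarrow> xs \<noteq> [] \<and> set xs \<subseteq> P \<and> successively (covby P) xs"

definition chain_from_to :: "'a::order set \<Rightarrow> 'a \<Rightarrow> 'a \<Rightarrow> 'a list \<Rightarrow> bool" where
  "chain_from_to P x y xs \<longleftrightarrow> cover_chain P xs \<and> hd xs = x \<and> last xs = y"

definition chain_length :: "'a list \<Rightarrow> nat" where
  "chain_length xs = length xs - 1"

definition rank_function :: "'a::order set \<Rightarrow> ('a \<Rightarrow> int) \<Rightarrow> bool" where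
  "rank_function P \<rho> \<longleftrightarrow> (\<forall>x y. covby P x y \<longrightarrow> \<rho> y = \<rho> x + 1)"

definition ranked :: "'a::order set \<Rightarrow> bool" where
  "ranked P \<longleftrightarrow> (\<exists>\<rho>. rank_function P \<rho>)"

definition hasse_connected :: "'a::order set \<Rightarrow> bool" where
  "hasse_connected P \<longleftrightarrow> P \<noteq> {} \<and> (\<forall>x\<in>P. \<forall>y\<in>P. equivclp (covby P) x y)"

section \<open>The posets \<open>d\<^sub>k(1)\<close> and the subsets modelled on them\<close>

text \<open>\<open>DA i\<close>, \<open>DB\<close>, \<open>DC\<close>, \<open>DF i\<close> are the elements \<open>a\<^sub>i\<close>, \<open>b\<close>, \<open>c\<close>, \<open>f\<^sub>i\<close>.\<close>

datatype dk_elem = DA nat | DB | DC | DF nat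

definition dk_carrier :: "nat \<Rightarrow> dk_elem set" where
  "dk_carrier k = DA ` {3..k} \<union> {DB, DC} \<union> DF ` {3..k}"

definition dk_cover :: "nat \<Rightarrow> dk_elem rel" where
  "dk_cover k =
     {(DA (Suc i), DA i) | i. 3 \<le> i \<and> i < k}
     \<union> {(DA 3, DB), (DA 3, DC), (DB, DF 3), (DC, DF 3)}
     \<union> {(DF i, DF (Suc i)) | i. 3 \<le> i \<and> i < k}"

definition dk_le :: "nat \<Rightarrow> dk_elem rel" where
  "dk_le k = (dk_cover k)\<^sup>*"

text \<open>
  \<open>S\<close>, with the induced order, is isomorphic to the subset \<open>T\<close> of \<open>d\<^sub>k(1)\<close>, with the order
  induced from \<open>d\<^sub>k(1)\<close>.
\<close>

definition iso_dk_part :: "nat \<Rightarrow> 'a::order set \<Rightarrow> dk_elem set \<Rightarrow> bool" where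
  "iso_dk_part k S T \<longleftrightarrow>
     (\<exists>f. bij_betw f S T \<and> (\<forall>x\<in>S. \<forall>y\<in>S. x \<le> y \<longleftrightarrow> (f x, f y) \<in> dk_le k))"

definition dk_interval :: "'a::order set \<Rightarrow> nat \<Rightarrow> 'a set \<Rightarrow> bool" where
  "dk_interval P k S \<longleftrightarrow> is_interval P S \<and> iso_dk_part k S (dk_carrier k)"

definition dk_minus_set :: "'a::order set \<Rightarrow> nat \<Rightarrow> 'a set \<Rightarrow> bool" where
  "dk_minus_set P k S \<longleftrightarrow> convex_in P S \<and> iso_dk_part k S (dk_carrier k - {DF k})"

definition dk_minus_interval :: "'a::order set \<Rightarrow> nat \<Rightarrow> 'a set \<Rightarrow> bool" where
  "dk_minus_interval P k S \<longleftrightarrow> is_interval P S \<and> dk_minus_set P k S"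

definition completing_element :: "'a::order set \<Rightarrow> nat \<Rightarrow> 'a set \<Rightarrow> 'a \<Rightarrow> bool" where
  "completing_element P k S z \<longleftrightarrow> dk_interval P k (insert z S) \<and> is_maximum (insert z S) z"

definition overlap :: "'a::order set \<Rightarrow> nat \<Rightarrow> 'a set \<Rightarrow> 'a set \<Rightarrow> bool" where
  "overlap P k S S' \<longleftrightarrow>
     (if k = 3 then
        \<exists>w w' x y. w \<noteq> w' \<and> x \<noteq> y \<and>
          covby P w x \<and> covby P w y \<and> covby P w' x \<and> covby P w' y \<and>
          S = {w, x, y} \<and> S' = {w', x, y}
      else
        \<exists>w w' u. \<exists>z'\<in>P. S = itv P w z' \<and> S' = itv P w' z' \<and>
          dk_minus_interval P k S \<and> dk_minus_interval P k S' \<and>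
          {v \<in> S. covby P w v} = {u} \<and> w' \<noteq> w \<and> covby P w' u)"

definition vee :: "'a::order set \<Rightarrow> 'a \<Rightarrow> 'a \<Rightarrow> 'a \<Rightarrow> bool" where
  "vee P w x y \<longleftrightarrow> x \<noteq> y \<and> covby P w x \<and> covby P w y"

definition vee_top :: "'a::order set \<Rightarrow> 'a \<Rightarrow> 'a \<Rightarrow> 'a \<Rightarrow> bool" where
  "vee_top P x y z \<longleftrightarrow> covby P x z \<and> covby P y z"

definition diamond :: "'a::order set \<Rightarrow> 'a \<Rightarrow> 'a \<Rightarrow> 'a \<Rightarrow> 'a \<Rightarrow> bool" where
  "diamond P w x y z \<longleftrightarrow> vee P w x y \<and> vee_top P x y z"

definition short_interval :: "'a::order set \<Rightarrow> 'a \<Rightarrow> 'a \<Rightarrow> bool" where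
  "short_interval P w z \<longleftrightarrow> (\<exists>u. covby P w u \<and> covby P u z)"

text \<open>\<open>[w;x,y]\<close> and \<open>[u,v;x,y]\<close>\<close>

definition itv2 :: "'a::order set \<Rightarrow> 'a \<Rightarrow> 'a \<Rightarrow> 'a \<Rightarrow> 'a set" where
  "itv2 P w x y = itv P w x \<union> itv P w y"

definition itv22 :: "'a::order set \<Rightarrow> 'a \<Rightarrow> 'a \<Rightarrow> 'a \<Rightarrow> 'a \<Rightarrow> 'a set" where
  "itv22 P u v x y = itv2 P u x y \<union> itv2 P v x y"

text \<open>The subset of \<open>d\<^sub>k(1)\<close> below is \<open>[a\<^sub>k;b,c]\<close>.\<close>

definition Yk_set :: "'a::order set \<Rightarrow> nat \<Rightarrow> 'a \<Rightarrow> 'a \<Rightarrow> 'a \<Rightarrow> bool" where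
  "Yk_set P k w x y \<longleftrightarrow> w \<in> P \<and> x \<in> P \<and> y \<in> P \<and>
     convex_in P (itv2 P w x y) \<and>
     iso_dk_part k (itv2 P w x y) (DA ` {3..k} \<union> {DB, DC})"

text \<open>
  The isomorphism in \<open>Yk_set\<close> necessarily sends \<open>x\<close>, \<open>y\<close> to \<open>b\<close>, \<open>c\<close>, so the stem elements
  \<open>w\<^sub>k, \<dots>, w\<^sub>3\<close> are those other than \<open>x\<close>, \<open>y\<close>.
\<close>

definition Yk_stem :: "'a::order set \<Rightarrow> 'a \<Rightarrow> 'a \<Rightarrow> 'a \<Rightarrow> 'a set" where
  "Yk_stem P w x y = itv2 P w x y - {x, y}"

definition LambdaYk_set :: "'a::order set \<Rightarrow> nat \<Rightarrow> 'a \<Rightarrow> 'a \<Rightarrow> 'a \<Rightarrow> 'a \<Rightarrow> bool" where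
  "LambdaYk_set P k u v x y \<longleftrightarrow> u \<noteq> v \<and> convex_in P (itv22 P u v x y) \<and>
     (\<exists>w. Yk_set P k w x y \<and> covby P u w \<and> covby P v w \<and>
          itv22 P u v x y = {u, v} \<union> itv2 P w x y)"

section \<open>\<open>d\<close>-completeness\<close>

text \<open>
  For \<open>k = 3\<close> the set \<open>S'\<close> has two maximal elements and \<open>z\<close> may not cover both of them; for
  \<open>k \<ge> 4\<close> it has just one.
\<close>

definition dk_complete :: "'a::order set \<Rightarrow> nat \<Rightarrow> bool" where
  "dk_complete P k \<longleftrightarrow>
     (\<forall>S. dk_minus_set P k S \<longrightarrow>
        (\<exists>z\<in>P. {y. covby P y z} = maximals S \<and>
           (\<forall>S'. dk_minus_set P k S' \<and> S' \<noteq> S \<longrightarrow> \<not> (\<forall>m\<in>maximals S'. covby P m z))))"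

definition d_complete :: "'a::order set \<Rightarrow> bool" where
  "d_complete P \<longleftrightarrow> (\<forall>k\<ge>3. dk_complete P k)"

section \<open>Axioms\<close>

definition VT :: "'a::order set \<Rightarrow> bool" where
  "VT P \<longleftrightarrow> (\<forall>w x y. x \<noteq> y \<and> covby P w x \<and> covby P w y \<longrightarrow> (\<exists>z. covby P x z \<and> covby P y z))"

definition FT :: "'a::order set \<Rightarrow> bool" where
  "FT P \<longleftrightarrow> (\<forall>w x y z. diamond P w x y z \<longrightarrow> (\<forall>v. covby P v z \<longrightarrow> v \<in> {x, y}))"

definition NCC :: "'a::order set \<Rightarrow> bool" where
  "NCC P \<longleftrightarrow> \<not> (\<exists>S S'. overlap P 3 S S')"

definition DkmC :: "'a::order set \<Rightarrow> nat \<Rightarrow> bool" where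
  "DkmC P k \<longleftrightarrow> (\<forall>S. dk_minus_set P k S \<longrightarrow> (\<exists>z. dk_interval P k (S \<union> {z})))"

definition DkMF :: "'a::order set \<Rightarrow> nat \<Rightarrow> bool" where
  "DkMF P k \<longleftrightarrow> (\<forall>I z. dk_interval P k I \<and> is_maximum I z \<longrightarrow> (\<forall>v. covby P v z \<longrightarrow> v \<in> I))"

definition DkmCF :: "'a::order set \<Rightarrow> nat \<Rightarrow> bool" where
  "DkmCF P k \<longleftrightarrow>
     (\<forall>S. dk_minus_set P k S \<longrightarrow>
        (\<exists>z. dk_interval P k (S \<union> {z}) \<and> is_maximum (S \<union> {z}) z \<and>
             (\<forall>v. covby P v z \<longrightarrow> v \<in> S)))"

definition NODkm :: "'a::order set \<Rightarrow> nat \<Rightarrow> bool" where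
  "NODkm P k \<longleftrightarrow> \<not> (\<exists>S S'. overlap P k S S')"

definition DkMD :: "'a::order set \<Rightarrow> nat \<Rightarrow> bool" where
  "DkMD P k \<longleftrightarrow>
     (\<forall>I J z z'. dk_interval P k I \<and> dk_interval P k J \<and> I \<noteq> J \<and>
        is_maximum I z \<and> is_maximum J z' \<longrightarrow> z \<noteq> z')"

section \<open>Properties\<close>

definition UPUE :: "'a::order set \<Rightarrow> bool" where
  "UPUE P \<longleftrightarrow>
     (\<forall>w\<in>P. \<forall>x\<in>P. \<forall>y\<in>P. w \<le> y \<and> covby P w x \<and> \<not> x \<le> y \<longrightarrow> (\<exists>z. covby P y z \<and> x \<le> z))"

definition UM :: "'a::order set \<Rightarrow> bool" where
  "UM P \<longleftrightarrow> (\<exists>!m. m \<in> maximals P)"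

definition CLMEE :: "'a::order set \<Rightarrow> bool" where
  "CLMEE P \<longleftrightarrow> UM P \<and>
     (\<forall>m\<in>maximals P. \<forall>w\<in>P. \<forall>xs ys. chain_from_to P w m xs \<and> chain_from_to P w m ys \<longrightarrow>
        chain_length xs = chain_length ys)"

definition CLE :: "'a::order set \<Rightarrow> bool" where
  "CLE P \<longleftrightarrow>
     (\<forall>x\<in>P. \<forall>y\<in>P. x < y \<longrightarrow>
        (\<forall>xs ys. chain_from_to P x y xs \<and> chain_from_to P x y ys \<longrightarrow>
           chain_length xs = chain_length ys))"

definition SS :: "'a::order set \<Rightarrow> bool" where
  "SS P \<longleftrightarrow> (\<forall>w z. short_interval P w z \<longrightarrow> card (itv P w z) \<in> {3, 4})"

definition DAI :: "'a::order set \<Rightarrow> bool" where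
  "DAI P \<longleftrightarrow> (\<forall>w x y z. diamond P w x y z \<longrightarrow> {w, x, y, z} = itv P w z)"

definition NTC :: "'a::order set \<Rightarrow> bool" where
  "NTC P \<longleftrightarrow>
     \<not> (\<exists>w x y z. x \<noteq> y \<and> x \<noteq> z \<and> y \<noteq> z \<and> covby P w x \<and> covby P w y \<and> covby P w z)"

definition UT :: "'a::order set \<Rightarrow> bool" where
  "UT P \<longleftrightarrow> (\<forall>w x y. vee P w x y \<longrightarrow> (\<exists>!z. vee_top P x y z))"

definition UCk :: "'a::order set \<Rightarrow> nat \<Rightarrow> bool" where
  "UCk P k \<longleftrightarrow> (\<forall>S. dk_minus_set P k S \<longrightarrow> (\<exists>!z. completing_element P k S z))"

definition YECOI :: "'a::order set \<Rightarrow> nat \<Rightarrow> bool" where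
  "YECOI P k \<longleftrightarrow>
     (\<forall>w x y. Yk_set P k w x y \<longrightarrow>
        (\<forall>s\<in>Yk_stem P w x y. \<forall>v. covby P s v \<longrightarrow> v \<in> itv2 P w x y))"

definition NLambdaYk :: "'a::order set \<Rightarrow> nat \<Rightarrow> bool" where
  "NLambdaYk P k \<longleftrightarrow> \<not> (\<exists>u v x y. LambdaYk_set P k u v x y)"

end

theory Submission
  imports Defs
begin

text \<open>
  The heart of the matter is that two convex sets isomorphic to \<open>[a\<^sub>k; b, c]\<close> which differ at most in
  the element \<open>a\<^sub>k\<close> are equal. Indeed, completing successively the \<open>d\<^sub>j\<^sup>-\<close>-sets for \<open>j < k\<close> adds
  \<open>f\<^sub>3, \<dots>\<close> to both of them at once, until both have become \<open>d\<^sub>k\<^sup>-\<close>-sets with the same maximal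
  elements; for the element given by \<open>d\<^sub>k\<close>-completeness this is impossible unless they coincide.
  For \<open>k = 3\<close> this is (NCC), and in general it excludes \<open>\<Lambda>Y\<^sub>k\<close>-sets. Turning \<open>d\<^sub>k(1)\<close> upside down,
  it also shows that a \<open>d\<^sub>k\<^sup>-\<close>-set has no completing element apart from the one given by
  \<open>d\<^sub>k\<close>-completeness, which yields the axioms. In the finite case (VT) and induction from the top
  give a rank function, and three covers of one element would generate an infinite ascending
  sequence of such triples.
\<close>

section \<open>Covers in locally finite posets\<close>

lemma covbyD:
  assumes "covby P x y"
  shows "x \<in> P" "y \<in> P" "x < y" "\<And>z. z \<in> P \<Longrightarrow> x \<le> z \<Longrightarrow> z \<le> y \<Longrightarrow> z = x \<or> z = y"
  using assms unfolding covby_def by (auto simp: order.order_iff_strict)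

lemma covby_incomparable:
  assumes "covby P w x" "covby P w y" "x \<noteq> y"
  shows "\<not> x \<le> y"
  using assms unfolding covby_def by (metis order.order_iff_strict)

lemma covby_incomparable_below:
  assumes "covby P x z" "covby P y z" "x \<noteq> y"
  shows "\<not> x \<le> y"
  using assms unfolding covby_def by (metis order.order_iff_strict)

lemma itv_iff: "v \<in> itv P x y \<longleftrightarrow> v \<in> P \<and> x \<le> v \<and> v \<le> y"
  by (auto simp: itv_def)

lemma locally_finite_cover_above:
  assumes "locally_finite P" "x \<in> P" "y \<in> P" "x < y"
  obtains u where "covby P x u" "u \<le> y"
proof -
  let ?A = "{v \<in> itv P x y. x < v}"
  have "finite (itv P x y)" using assms by (auto simp: locally_finite_def)
  then have "finite ?A" by simp
  moreover have "y \<in> ?A" using assms by (simp add: itv_iff)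
  ultimately obtain u where u: "u \<in> ?A" "\<And>v. v \<in> ?A \<Longrightarrow> v \<le> u \<Longrightarrow> u = v"
    using finite_has_minimal[of ?A] by blast
  have "covby P x u"
    unfolding covby_def using u assms
    by (auto simp: itv_iff) (metis less_le_not_le order.trans)
  then show thesis using u that by (auto simp: itv_iff)
qed

lemma locally_finite_cover_below:
  assumes "locally_finite P" "x \<in> P" "y \<in> P" "x < y"
  obtains u where "covby P u y" "x \<le> u"
proof -
  let ?A = "{v \<in> itv P x y. v < y}"
  have "finite (itv P x y)" using assms by (auto simp: locally_finite_def)
  then have "finite ?A" by simp
  moreover have "x \<in> ?A" using assms by (simp add: itv_iff)
  ultimately obtain u where u: "u \<in> ?A" "\<And>v. v \<in> ?A \<Longrightarrow> u \<le> v \<Longrightarrow> u = v"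
    using finite_has_maximal[of ?A] by blast
  have "covby P u y"
    unfolding covby_def using u assms
    by (auto simp: itv_iff) (metis less_le_not_le order.trans)
  then show thesis using u that by (auto simp: itv_iff)
qed

section \<open>Embeddings of parts of the double-tailed diamonds\<close>

text \<open>\<open>dk_part m n\<close> is \<open>{a\<^sub>m,\<dots>,a\<^sub>3; b, c; f\<^sub>3,\<dots>,f\<^sub>n}\<close>; one of the two tails
  is absent if its index is 2.\<close>

definition dk_part :: "nat \<Rightarrow> nat \<Rightarrow> dk_elem set" where
  "dk_part m n = DA ` {3..m} \<union> {DB, DC} \<union> DF ` {3..n}"

text \<open>The maximal elements of \<open>dk_part m n\<close>. An empty upper tail
  (\<open>n = 2\<close>) leaves two of them, which lets k = 3 be treated together with k \<ge>
  4.\<close>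

definition dk_tops :: "nat \<Rightarrow> dk_elem set" where
  "dk_tops n = (if n < 3 then {DB, DC} else {DF n})"

text \<open>A closed form of \<open>dk_le k\<close> that does not mention \<open>k\<close>, so parts
  of different sizes carry the same order. The indices of \<open>DA\<close> decrease
  upwards.\<close>

fun dk_ord :: "dk_elem \<Rightarrow> dk_elem \<Rightarrow> bool" where
  "dk_ord (DA i) t = (case t of DA j \<Rightarrow> j \<le> i | _ \<Rightarrow> True)"
| "dk_ord DB t = (case t of DB \<Rightarrow> True | DF _ \<Rightarrow> True | _ \<Rightarrow> False)"
| "dk_ord DC t = (case t of DC \<Rightarrow> True | DF _ \<Rightarrow> True | _ \<Rightarrow> False)"
| "dk_ord (DF i) t = (case t of DF j \<Rightarrow> i \<le> j | _ \<Rightarrow> False)"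

lemma dk_part_simps [simp]:
  "DA i \<in> dk_part m n \<longleftrightarrow> 3 \<le> i \<and> i \<le> m"
  "DB \<in> dk_part m n"
  "DC \<in> dk_part m n"
  "DF i \<in> dk_part m n \<longleftrightarrow> 3 \<le> i \<and> i \<le> n"
  by (auto simp: dk_part_def)

lemma dk_part_mono: "m \<le> m' \<Longrightarrow> n \<le> n' \<Longrightarrow> dk_part m n \<subseteq> dk_part m' n'"
  by (auto simp: dk_part_def)

text \<open>Shortening the tails at their outer ends leaves no gaps; this is what lets an embedding
  be restricted.\<close>

lemma dk_part_convex:
  assumes "t \<in> dk_part m' n'" "s \<in> dk_part m n" "r \<in> dk_part m n" "dk_ord s t" "dk_ord t r"
  shows "t \<in> dk_part m n"
  using assms by (cases s; cases t; cases r) auto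

lemma dk_carrier_eq: "dk_carrier k = dk_part k k"
  by (simp add: dk_carrier_def dk_part_def)

lemma dk_carrier_minus_eq:
  assumes "3 \<le> k"
  shows "dk_carrier k - {DF k} = dk_part k (k - 1)"
proof -
  have "s \<in> dk_part k k - {DF k} \<longleftrightarrow> s \<in> dk_part k (k - 1)" for s
    using assms by (cases s) auto
  then show ?thesis by (auto simp: dk_carrier_eq)
qed

lemma dk_part_Suc_top: "2 \<le> n \<Longrightarrow> dk_part m (Suc n) = insert (DF (Suc n)) (dk_part m n)"
  by (auto simp: dk_part_def atLeastAtMostSuc_conv)

lemma dk_part_Suc_bot: "2 \<le> m \<Longrightarrow> dk_part (Suc m) n = insert (DA (Suc m)) (dk_part m n)"
  by (auto simp: dk_part_def atLeastAtMostSuc_conv)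

lemma dk_ord_refl [simp]: "dk_ord s s"
  by (cases s) auto

lemma dk_ord_trans: "dk_ord s t \<Longrightarrow> dk_ord t r \<Longrightarrow> dk_ord s r"
  by (cases s; cases t; cases r) auto

lemma dk_ord_antisym: "dk_ord s t \<Longrightarrow> dk_ord t s \<Longrightarrow> s = t"
  by (cases s; cases t) auto

lemma dk_tops_subset: "2 \<le> n \<Longrightarrow> dk_tops n \<subseteq> dk_part m n"
  by (auto simp: dk_tops_def)

lemma dk_tops_above:
  assumes "2 \<le> n" "s \<in> dk_part m n"
  shows "\<exists>t\<in>dk_tops n. dk_ord s t"
  using assms by (cases s) (auto simp: dk_tops_def)

lemma dk_le_imp_ord: "(s, t) \<in> dk_le k \<Longrightarrow> dk_ord s t"
  unfolding dk_le_def
  by (induction rule: rtrancl_induct) (auto simp: dk_cover_def intro: dk_ord_trans)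

lemma dk_le_DA:
  assumes "3 \<le> i" "i \<le> j" "j \<le> k"
  shows "(DA j, DA i) \<in> dk_le k"
  using assms(2,3)
proof (induction j rule: dec_induct)
  case base
  then show ?case by (simp add: dk_le_def)
next
  case (step n)
  then have "(DA (Suc n), DA n) \<in> dk_cover k" using assms(1) by (auto simp: dk_cover_def)
  then show ?case using step
    by (metis Suc_leD converse_rtrancl_into_rtrancl dk_le_def)
qed

lemma dk_le_DF:
  assumes "3 \<le> i" "i \<le> j" "j \<le> k"
  shows "(DF i, DF j) \<in> dk_le k"
  using assms(2,3)
proof (induction j rule: dec_induct)
  case base
  then show ?case by (simp add: dk_le_def)
next
  case (step n)
  then have "(DF n, DF (Suc n)) \<in> dk_cover k" using assms(1) by (auto simp: dk_cover_def)
  then show ?case using step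
    by (metis Suc_leD rtrancl.rtrancl_into_rtrancl dk_le_def)
qed

lemma dk_le_iff_ord:
  assumes "s \<in> dk_carrier k" "t \<in> dk_carrier k"
  shows "(s, t) \<in> dk_le k \<longleftrightarrow> dk_ord s t"
proof
  assume ord: "dk_ord s t"
  have trans: "(p, q) \<in> dk_le k \<Longrightarrow> (q, r) \<in> dk_le k \<Longrightarrow> (p, r) \<in> dk_le k" for p q r
    by (simp add: dk_le_def)
  have mid: "(DA 3, DB) \<in> dk_le k" "(DA 3, DC) \<in> dk_le k"
    "(DB, DF 3) \<in> dk_le k" "(DC, DF 3) \<in> dk_le k"
    by (auto simp: dk_le_def dk_cover_def)
  have A: "(DA i, DB) \<in> dk_le k" "(DA i, DC) \<in> dk_le k" if "3 \<le> i" "i \<le> k" for i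
    using trans[OF dk_le_DA mid(1)] trans[OF dk_le_DA mid(2)] that by auto
  have F: "(DB, DF i) \<in> dk_le k" "(DC, DF i) \<in> dk_le k" if "3 \<le> i" "i \<le> k" for i
    using trans[OF mid(3) dk_le_DF] trans[OF mid(4) dk_le_DF] that by auto
  have refl: "(p, p) \<in> dk_le k" for p by (simp add: dk_le_def)
  show "(s, t) \<in> dk_le k"
    using assms ord unfolding dk_carrier_eq
    by (cases s; cases t) (auto intro: dk_le_DA dk_le_DF A F refl trans[OF A(1) F(1)])
qed (rule dk_le_imp_ord)

text \<open>A map out of the model, rather than into it, gives the elements of \<open>S\<close>
  names such as \<open>g (DF n)\<close>. Its injectivity comes from the antisymmetry of
  \<open>dk_ord\<close>.\<close>

lemma iso_dk_part_iff:
  assumes "T \<subseteq> dk_carrier k"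
  shows "iso_dk_part k S T \<longleftrightarrow>
    (\<exists>g. g ` T = S \<and> (\<forall>s\<in>T. \<forall>t\<in>T. g s \<le> g t \<longleftrightarrow> dk_ord s t))"
proof
  assume "iso_dk_part k S T"
  then obtain f where f: "bij_betw f S T"
    "\<forall>x\<in>S. \<forall>y\<in>S. x \<le> y \<longleftrightarrow> (f x, f y) \<in> dk_le k"
    by (auto simp: iso_dk_part_def)
  let ?g = "inv_into S f"
  have g: "bij_betw ?g T S" by (rule bij_betw_inv_into[OF f(1)])
  have "?g s \<in> S \<and> f (?g s) = s" if "s \<in> T" for s
    using that f(1) by (metis bij_betw_imp_surj_on f_inv_into_f inv_into_into)
  then have "\<forall>s\<in>T. \<forall>t\<in>T. ?g s \<le> ?g t \<longleftrightarrow> dk_ord s t"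
    using f(2) assms dk_le_iff_ord by (metis subsetD)
  then show "\<exists>g. g ` T = S \<and> (\<forall>s\<in>T. \<forall>t\<in>T. g s \<le> g t \<longleftrightarrow> dk_ord s t)"
    using g by (auto simp: bij_betw_def)
next
  assume "\<exists>g. g ` T = S \<and> (\<forall>s\<in>T. \<forall>t\<in>T. g s \<le> g t \<longleftrightarrow> dk_ord s t)"
  then obtain g where g: "g ` T = S" "\<forall>s\<in>T. \<forall>t\<in>T. g s \<le> g t \<longleftrightarrow> dk_ord s t"
    by blast
  have inj: "inj_on g T" using g(2) by (intro inj_onI) (metis dk_ord_antisym order_refl)
  then have bij: "bij_betw g T S" using g(1) by (simp add: bij_betw_def)
  let ?f = "inv_into T g"
  have "\<forall>x\<in>S. ?f x \<in> T \<and> g (?f x) = x"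
    using g(1) by (auto intro: inv_into_into f_inv_into_f)
  then have "\<forall>x\<in>S. \<forall>y\<in>S. x \<le> y \<longleftrightarrow> (?f x, ?f y) \<in> dk_le k"
    using g(2) assms dk_le_iff_ord by (metis subsetD)
  then show "iso_dk_part k S T"
    unfolding iso_dk_part_def using bij_betw_inv_into[OF bij] by blast
qed

text \<open>For k \<ge> 3 and (m, n) = (k, k - 1), (k, k), (k, 2) the images are the
  \<open>d_k^-\<close>-sets, the \<open>d_k\<close>-intervals and the sets shaped like
  \<open>[a_k; b, c]\<close>. Only values on \<open>dk_part m n\<close> are constrained, so new
  elements are adjoined by function update.\<close>

definition dk_emb :: "'a::order set \<Rightarrow> nat \<Rightarrow> nat \<Rightarrow> (dk_elem \<Rightarrow> 'a) \<Rightarrow> bool" where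
  "dk_emb P m n g \<longleftrightarrow> convex_in P (g ` dk_part m n) \<and>
     (\<forall>s\<in>dk_part m n. \<forall>t\<in>dk_part m n. g s \<le> g t \<longleftrightarrow> dk_ord s t)"

lemma dk_emb_le_iff:
  "dk_emb P m n g \<Longrightarrow> s \<in> dk_part m n \<Longrightarrow> t \<in> dk_part m n \<Longrightarrow> g s \<le> g t \<longleftrightarrow> dk_ord s t"
  by (simp add: dk_emb_def)

lemma dk_emb_eq_iff:
  "dk_emb P m n g \<Longrightarrow> s \<in> dk_part m n \<Longrightarrow> t \<in> dk_part m n \<Longrightarrow> g s = g t \<longleftrightarrow> s = t"
  by (metis dk_emb_le_iff dk_ord_antisym order_refl)

lemma dk_emb_less_iff:
  "dk_emb P m n g \<Longrightarrow> s \<in> dk_part m n \<Longrightarrow> t \<in> dk_part m n \<Longrightarrow>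
    g s < g t \<longleftrightarrow> dk_ord s t \<and> s \<noteq> t"
  by (metis dk_emb_le_iff dk_emb_eq_iff order.strict_iff_order)

lemma dk_emb_in: "dk_emb P m n g \<Longrightarrow> s \<in> dk_part m n \<Longrightarrow> g s \<in> P"
  by (auto simp: dk_emb_def convex_in_def)

lemma dk_emb_between:
  assumes "dk_emb P m n g" "s \<in> dk_part m n" "t \<in> dk_part m n" "v \<in> P" "g s \<le> v" "v \<le> g t"
  obtains r where "r \<in> dk_part m n" "v = g r" "dk_ord s r" "dk_ord r t"
proof -
  have "v \<in> g ` dk_part m n"
    using assms unfolding dk_emb_def convex_in_def by (meson image_eqI itv_iff subsetD)
  then show thesis using that assms by (auto simp: dk_emb_le_iff)
qed

lemma dk_emb_covby:
  assumes g: "dk_emb P m n g" and st: "s \<in> dk_part m n" "t \<in> dk_part m n" "dk_ord s t" "s \<noteq> t"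
    and "\<And>r. r \<in> dk_part m n \<Longrightarrow> dk_ord s r \<Longrightarrow> dk_ord r t \<Longrightarrow> r = s \<or> r = t"
  shows "covby P (g s) (g t)"
  unfolding covby_def
proof (intro conjI notI)
  show "g s \<in> P" "g t \<in> P" "g s < g t" using assms by (auto simp: dk_emb_in dk_emb_less_iff)
  assume "\<exists>z\<in>P. g s < z \<and> z < g t"
  then obtain z where "z \<in> P" "g s < z" "z < g t" by blast
  then show False using assms dk_emb_between[OF g st(1,2)] by (metis order.strict_iff_order)
qed

lemma dk_emb_subset:
  assumes g: "dk_emb P m n g" and "m' \<le> m" "n' \<le> n"
  shows "dk_emb P m' n' g"
  unfolding dk_emb_def convex_in_def
proof (intro conjI ballI subsetI)
  have sub: "dk_part m' n' \<subseteq> dk_part m n" by (rule dk_part_mono[OF assms(2,3)])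
  show "x \<in> P" if "x \<in> g ` dk_part m' n'" for x using that g sub dk_emb_in by blast
  show "g s \<le> g t \<longleftrightarrow> dk_ord s t" if "s \<in> dk_part m' n'" "t \<in> dk_part m' n'" for s t
    using that g sub dk_emb_le_iff by blast
  fix x y v assume x: "x \<in> g ` dk_part m' n'" "y \<in> g ` dk_part m' n'" "v \<in> itv P x y"
  then obtain s t where st: "x = g s" "y = g t" "s \<in> dk_part m' n'" "t \<in> dk_part m' n'" by blast
  moreover have "v \<in> P" "g s \<le> v" "v \<le> g t" using x(3) st by (auto simp: itv_iff)
  ultimately obtain r where "r \<in> dk_part m n" "v = g r" "dk_ord s r" "dk_ord r t"
    using dk_emb_between[OF g] sub by blast
  then show "v \<in> g ` dk_part m' n'" using dk_part_convex st by blast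
qed

lemma dk_emb_maximals:
  assumes g: "dk_emb P m n g" and "2 \<le> n"
  shows "maximals (g ` dk_part m n) = g ` dk_tops n"
proof -
  have "s \<in> dk_tops n \<longleftrightarrow> \<not> (\<exists>t\<in>dk_part m n. dk_ord s t \<and> s \<noteq> t)" if "s \<in> dk_part m n" for s
  proof -
    have "s \<in> dk_tops n" if "\<forall>t\<in>dk_part m n. dk_ord s t \<longrightarrow> s = t"
      using dk_tops_above[OF assms(2) \<open>s \<in> dk_part m n\<close>] dk_tops_subset[OF assms(2)] that by blast
    moreover have "s = t" if "s \<in> dk_tops n" "t \<in> dk_part m n" "dk_ord s t" for t
      using that by (cases t) (auto simp: dk_tops_def split: if_splits)
    ultimately show ?thesis by blast
  qed
  then show ?thesis
    using dk_tops_subset[OF assms(2), of m] dk_emb_less_iff[OF g]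
    unfolding maximals_def by blast
qed

section \<open>Recognising \<open>d_k^-\<close>-sets and \<open>d_k\<close>-intervals by
  embeddings\<close>

lemma dk_minus_set_iff:
  assumes "3 \<le> k"
  shows "dk_minus_set P k S \<longleftrightarrow> (\<exists>g. dk_emb P k (k - 1) g \<and> S = g ` dk_part k (k - 1))"
proof -
  have "dk_part k (k - 1) \<subseteq> dk_carrier k"
    using dk_part_mono[of k k "k - 1" k] by (simp add: dk_carrier_eq)
  from iso_dk_part_iff[OF this] show ?thesis
    unfolding dk_minus_set_def dk_carrier_minus_eq[OF assms] dk_emb_def by auto
qed

text \<open>A convex copy of the whole model is an interval because it has the least element
  \<open>g (DA k)\<close> and the greatest element \<open>g (DF k)\<close>.\<close>

lemma dk_interval_iff:
  assumes "3 \<le> k"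
  shows "dk_interval P k S \<longleftrightarrow> (\<exists>g. dk_emb P k k g \<and> S = g ` dk_part k k)"
proof
  assume S: "dk_interval P k S"
  then obtain g where g: "g ` dk_part k k = S"
    "\<forall>s\<in>dk_part k k. \<forall>t\<in>dk_part k k. g s \<le> g t \<longleftrightarrow> dk_ord s t"
    unfolding dk_interval_def dk_carrier_eq using iso_dk_part_iff[of "dk_part k k" k S]
    by (auto simp: dk_carrier_eq)
  have "convex_in P S"
    using S unfolding dk_interval_def is_interval_def convex_in_def by (auto simp: itv_iff)
  then show "\<exists>g. dk_emb P k k g \<and> S = g ` dk_part k k" using g by (auto simp: dk_emb_def)
next
  assume "\<exists>g. dk_emb P k k g \<and> S = g ` dk_part k k"
  then obtain g where g: "dk_emb P k k g" and S: "S = g ` dk_part k k" by blast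
  have min: "dk_ord (DA k) s" and max: "dk_ord s (DF k)" if "s \<in> dk_part k k" for s
    using that by (cases s; auto)+
  have mm: "DA k \<in> dk_part k k" "DF k \<in> dk_part k k" using assms by auto
  have "S = itv P (g (DA k)) (g (DF k))"
  proof
    show "S \<subseteq> itv P (g (DA k)) (g (DF k))"
      using S min max mm dk_emb_in[OF g] dk_emb_le_iff[OF g] by (auto simp: itv_iff)
    show "itv P (g (DA k)) (g (DF k)) \<subseteq> S"
      using g mm S by (auto simp: dk_emb_def convex_in_def)
  qed
  moreover have "g (DA k) \<le> g (DF k)" using dk_emb_le_iff[OF g] min mm by simp
  ultimately have "is_interval P S" unfolding is_interval_def using dk_emb_in[OF g] mm by blast
  moreover have "iso_dk_part k S (dk_part k k)"
    using iso_dk_part_iff[of "dk_part k k" k S] g S by (auto simp: dk_carrier_eq dk_emb_def)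
  ultimately show "dk_interval P k S" by (simp add: dk_interval_def dk_carrier_eq)
qed

lemma dk_emb_is_maximum:
  assumes g: "dk_emb P m n g" and "3 \<le> n"
  shows "is_maximum (g ` dk_part m n) z \<longleftrightarrow> z = g (DF n)"
proof -
  have max: "g s \<le> g (DF n)" if "s \<in> dk_part m n" for s
    using that assms dk_emb_le_iff[OF g] by (cases s) auto
  moreover have "DF n \<in> dk_part m n" using assms by simp
  ultimately show ?thesis unfolding is_maximum_def by (auto intro!: antisym)
qed

lemma dk_emb_image_remove_top:
  assumes g: "dk_emb P k k g" and "3 \<le> k"
  shows "g ` dk_part k k = insert (g (DF k)) (g ` dk_part k (k - 1))"
    and "g (DF k) \<notin> g ` dk_part k (k - 1)"
proof -
  show "g ` dk_part k k = insert (g (DF k)) (g ` dk_part k (k - 1))"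
    using dk_part_Suc_top[of "k - 1" k] assms(2) by simp
  have "s \<in> dk_part k k \<and> s \<noteq> DF k" if "s \<in> dk_part k (k - 1)" for s
    using that assms(2) by (cases s) auto
  then show "g (DF k) \<notin> g ` dk_part k (k - 1)"
    using dk_emb_eq_iff[OF g] assms(2) by (metis dk_part_simps(4) image_iff order_refl)
qed

text \<open>Convexity rests on knowing all lower covers of \<open>z\<close>: by local finiteness,
  whatever lies strictly below \<open>z\<close> lies below one of the old tops, and then the
  convexity of the old image applies.\<close>

lemma dk_emb_extend_top:
  assumes lf: "locally_finite P" and g: "dk_emb P m n g" and n: "2 \<le> n"
    and z: "z \<in> P" "{y. covby P y z} = g ` dk_tops n"
  shows "dk_emb P m (Suc n) (g(DF (Suc n) := z))"
proof -
  let ?S = "g ` dk_part m n" and ?h = "g(DF (Suc n) := z)"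
  have eq: "dk_part m (Suc n) = insert (DF (Suc n)) (dk_part m n)" by (rule dk_part_Suc_top[OF n])
  have new: "DF (Suc n) \<notin> dk_part m n" by simp
  then have h: "?h s = g s" if "s \<in> dk_part m n" for s using that by auto
  then have img: "?h ` dk_part m (Suc n) = insert z ?S"
    unfolding eq image_insert by (simp cong: image_cong del: fun_upd_apply) (simp)
  have below: "g s < z" if s: "s \<in> dk_part m n" for s
  proof -
    obtain t where t: "t \<in> dk_tops n" "dk_ord s t" using dk_tops_above[OF n s] by blast
    then have "g s \<le> g t" using g s dk_tops_subset[OF n] dk_emb_le_iff by blast
    moreover have "covby P (g t) z" using z(2) t(1) by blast
    ultimately show ?thesis by (metis covbyD(3) order.strict_trans1)
  qed
  have "convex_in P (insert z ?S)"
    unfolding convex_in_def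
  proof (intro conjI ballI subsetI)
    show "x \<in> P" if "x \<in> insert z ?S" for x using that z(1) g dk_emb_in by blast
    fix x y v assume x: "x \<in> insert z ?S" "y \<in> insert z ?S" "v \<in> itv P x y"
    then have v: "v \<in> P" "x \<le> v" "v \<le> y" by (auto simp: itv_iff)
    show "v \<in> insert z ?S"
    proof (cases "v = z")
      case False
      have "y \<le> z" using x(2) below by (auto simp: less_imp_le)
      then have "v < z" using v(3) False by auto
      then obtain u where u: "covby P u z" "v \<le> u"
        using locally_finite_cover_below[OF lf v(1) z(1)] by blast
      then have "u \<in> ?S" using z(2) dk_tops_subset[OF n] by blast
      moreover have "x \<in> ?S" using x(1) v(2) \<open>v < z\<close> by auto
      ultimately have "itv P x u \<subseteq> ?S"
        using g unfolding dk_emb_def convex_in_def by blast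
      then show ?thesis using v u by (auto simp: itv_iff)
    qed simp
  qed
  moreover have "?h s \<le> ?h t \<longleftrightarrow> dk_ord s t"
    if "s \<in> dk_part m (Suc n)" "t \<in> dk_part m (Suc n)" for s t
  proof -
    have up: "dk_ord r (DF (Suc n))" "\<not> dk_ord (DF (Suc n)) r" if "r \<in> dk_part m n" for r
      using that by (cases r; auto)+
    have "\<not> z \<le> g r" "g r \<le> z" if "r \<in> dk_part m n" for r
      using below[OF that] by auto
    with that up h show ?thesis
      unfolding eq by (auto simp: dk_emb_le_iff[OF g])
  qed
  ultimately show ?thesis by (simp add: dk_emb_def img del: fun_upd_apply)
qed

text \<open>Lengthens the stem downwards. Convexity is a hypothesis here, since the covering of
  \<open>u\<close> by \<open>g (DA k)\<close> says nothing about other upper covers of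
  \<open>u\<close>.\<close>

lemma dk_emb_extend_bottom:
  assumes g: "dk_emb P k n g" and k: "3 \<le> k" and u: "covby P u (g (DA k))"
    and convex: "convex_in P (insert u (g ` dk_part k n))"
  shows "dk_emb P (Suc k) n (g(DA (Suc k) := u))"
proof -
  let ?h = "g(DA (Suc k) := u)"
  have eq: "dk_part (Suc k) n = insert (DA (Suc k)) (dk_part k n)" using k by (simp add: dk_part_Suc_bot)
  have h: "?h s = g s" if "s \<in> dk_part k n" for s using that by auto
  then have img: "?h ` dk_part (Suc k) n = insert u (g ` dk_part k n)"
    unfolding eq image_insert by (simp cong: image_cong del: fun_upd_apply) simp
  have above: "u \<le> g s" "\<not> g s \<le> u" if s: "s \<in> dk_part k n" for s
  proof -
    have "dk_ord (DA k) s" using s by (cases s) auto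
    then have "g (DA k) \<le> g s" using dk_emb_le_iff[OF g _ s] k by simp
    then show "u \<le> g s" "\<not> g s \<le> u" using covbyD(3)[OF u] by auto
  qed
  have "dk_ord (DA (Suc k)) s" "\<not> dk_ord s (DA (Suc k))" if "s \<in> dk_part k n" for s
    using that by (cases s; auto)+
  then have "?h s \<le> ?h t \<longleftrightarrow> dk_ord s t"
    if "s \<in> dk_part (Suc k) n" "t \<in> dk_part (Suc k) n" for s t
    using that above h unfolding eq by (auto simp: dk_emb_le_iff[OF g])
  then show ?thesis using convex unfolding dk_emb_def img by blast
qed

section \<open>The axioms of part (a)\<close>

lemma d_complete_witness:
  assumes "d_complete P" "3 \<le> k" and g: "dk_emb P k (k - 1) g"
  obtains z where "z \<in> P" "{y. covby P y z} = g ` dk_tops (k - 1)"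
    "\<And>S'. dk_minus_set P k S' \<Longrightarrow> S' \<noteq> g ` dk_part k (k - 1) \<Longrightarrow>
      \<not> (\<forall>m\<in>maximals S'. covby P m z)"
proof -
  have "dk_minus_set P k (g ` dk_part k (k - 1))" using dk_minus_set_iff assms by blast
  moreover have "maximals (g ` dk_part k (k - 1)) = g ` dk_tops (k - 1)"
    using dk_emb_maximals[OF g] assms(2) by simp
  ultimately show thesis using assms(1,2) that unfolding d_complete_def dk_complete_def by metis
qed

locale d_complete_poset =
  fixes P :: "'a::order set"
  assumes lf: "locally_finite P" and dc: "d_complete P"
begin

text \<open>Completing \<open>a\<^sub>3 \<rightarrow> {b, c}\<close>, then \<open>[a\<^sub>4, f\<^sub>3]\<close>, and so on up to \<open>[a\<^sub>k\<^sub>-\<^sub>1, f\<^sub>k\<^sub>-\<^sub>2]\<close> does not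
  involve \<open>a\<^sub>k\<close>, so two choices of \<open>a\<^sub>k\<close> give two \<open>d\<^sub>k\<^sup>-\<close>-sets with the same maximal elements.\<close>

lemma stem_end_unique:
  assumes k: "3 \<le> k" and "dk_emb P k 2 (h(DA k := u))" "dk_emb P k 2 (h(DA k := v))"
  shows "u = v"
proof (rule ccontr)
  assume "u \<noteq> v"
  \<comment> \<open>No top is \<open>DA k\<close>, so exchanging \<open>u\<close> for
    \<open>v\<close> leaves the prescribed lower covers unchanged.\<close>
  have top: "DA k \<notin> dk_tops n" for n by (simp add: dk_tops_def)
  have "2 \<le> k - 1" using k by simp
  have "\<exists>h'. dk_emb P k n (h'(DA k := u)) \<and> dk_emb P k n (h'(DA k := v))"
    if "2 \<le> n" "n \<le> k - 1" for n
    using that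
  proof (induction n rule: dec_induct)
    case base
    then show ?case using assms by blast
  next
    case (step n)
    then obtain h' where h': "dk_emb P k n (h'(DA k := u))" "dk_emb P k n (h'(DA k := v))"
      using Suc_leD by blast
    \<comment> \<open>Here \<open>Suc n < k\<close>, so \<open>dk_part (Suc n) n\<close> omits
      \<open>DA k\<close> and its image is the same for both embeddings; the one completion
      \<open>z\<close> becomes \<open>DF (Suc n)\<close> in both.\<close>
    have "dk_emb P (Suc n) (Suc n - 1) (h'(DA k := u))"
      using dk_emb_subset[OF h'(1)] step by simp
    from d_complete_witness[OF dc _ this] step
    obtain z where z: "z \<in> P" "{y. covby P y z} = (h'(DA k := u)) ` dk_tops n"
      by (metis Suc_le_mono diff_Suc_1 eval_nat_numeral(3))
    then have z': "{y. covby P y z} = (h'(DA k := v)) ` dk_tops n" using top by simp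
    let ?h = "h'(DF (Suc n) := z)"
    have "dk_emb P k (Suc n) (?h(DA k := u))" "dk_emb P k (Suc n) (?h(DA k := v))"
      using dk_emb_extend_top[OF lf h'(1) _ z] dk_emb_extend_top[OF lf h'(2) _ z(1) z'] step
      by (simp_all add: fun_upd_twist)
    then show ?case by blast
  qed
  then obtain h' where h': "dk_emb P k (k - 1) (h'(DA k := u))" "dk_emb P k (k - 1) (h'(DA k := v))"
    using \<open>2 \<le> k - 1\<close> by blast
  let ?gu = "h'(DA k := u)" and ?gv = "h'(DA k := v)"
  let ?Su = "?gu ` dk_part k (k - 1)" and ?Sv = "?gv ` dk_part k (k - 1)"
  obtain z where z: "z \<in> P" "{y. covby P y z} = ?gu ` dk_tops (k - 1)"
    "\<And>S'. dk_minus_set P k S' \<Longrightarrow> S' \<noteq> ?Su \<Longrightarrow> \<not> (\<forall>m\<in>maximals S'. covby P m z)"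
    using d_complete_witness[OF dc k h'(1)] by blast
  have "maximals ?Sv = ?gu ` dk_tops (k - 1)"
    using dk_emb_maximals[OF h'(2)] \<open>2 \<le> k - 1\<close> top by simp
  then have "\<forall>m\<in>maximals ?Sv. covby P m z" using z(2) by blast
  moreover have "dk_minus_set P k ?Sv" using dk_minus_set_iff[OF k] h'(2) by blast
  ultimately have eq: "?Sv = ?Su" using z(3) by blast
  \<comment> \<open>Both \<open>u\<close> and \<open>v\<close> are the least element of the common
    set.\<close>
  have mem: "DA k \<in> dk_part k (k - 1)" using k by simp
  have bot: "dk_ord (DA k) s" if "s \<in> dk_part k (k - 1)" for s using that by (cases s) auto
  have "u \<le> x" if "x \<in> ?Su" for x
    using that dk_emb_le_iff[OF h'(1) mem] bot by force
  moreover have "v \<le> x" if "x \<in> ?Sv" for x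
    using that dk_emb_le_iff[OF h'(2) mem] bot by force
  moreover have "u \<in> ?Su" "v \<in> ?Sv" using mem by (metis fun_upd_same image_eqI)+
  ultimately show False using eq \<open>u \<noteq> v\<close> by (metis antisym)
qed

text \<open>If \<open>z \<noteq> f\<^sub>k\<close> completed the same \<open>d\<^sub>k\<^sup>-\<close>-set, then \<open>f\<^sub>3 \<rightarrow> \<dots> \<rightarrow> f\<^sub>k\<^sub>-\<^sub>1 \<rightarrow> {f\<^sub>k, z}\<close> would be
  part of a longer stem ending in \<open>b\<close> as well as of one ending in \<open>c\<close>.\<close>

lemma top_unique:
  assumes k: "3 \<le> k" and g: "dk_emb P k k g"
    and z: "z \<in> P" "{y. covby P y z} = g ` dk_tops (k - 1)"
  shows "z = g (DF k)"
proof (rule ccontr)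
  assume ne: "z \<noteq> g (DF k)"
  have tp: "t \<in> dk_part k (k - 1)" "t \<in> dk_part k k" "dk_ord t (DF k)" "t \<noteq> DF k"
    if "t \<in> dk_tops (k - 1)" for t
    using that k by (auto simp: dk_tops_def split: if_splits)
  have c1: "covby P (g t) z" if "t \<in> dk_tops (k - 1)" for t using z(2) that by blast
  have c2: "covby P (g t) (g (DF k))" if t: "t \<in> dk_tops (k - 1)" for t
  proof (rule dk_emb_covby[OF g tp(2)[OF t] _ tp(3,4)[OF t]])
    show "DF k \<in> dk_part k k" using k by simp
    show "r = t \<or> r = DF k" if "r \<in> dk_part k k" "dk_ord t r" "dk_ord r (DF k)" for r
      using that t by (cases r) (auto simp: dk_tops_def split: if_splits)
  qed
  obtain t0 where t0: "t0 \<in> dk_tops (k - 1)" using dk_tops_above[of "k - 1" DB k] k by force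
  have inc: "\<not> z \<le> g (DF k)" "\<not> g (DF k) \<le> z"
    using covby_incomparable[OF c1[OF t0] c2[OF t0]] covby_incomparable[OF c2[OF t0] c1[OF t0]] ne
    by auto
  have below: "g s \<le> z" "\<not> z \<le> g s" if s: "s \<in> dk_part k (k - 1)" for s
  proof -
    obtain t where t: "t \<in> dk_tops (k - 1)" "dk_ord s t"
      using dk_tops_above[OF _ s] k by force
    have "s \<in> dk_part k k" using s dk_part_mono[of k k "k - 1" k] by auto
    then have "g s \<le> g t" using t dk_emb_le_iff[OF g] tp by blast
    moreover have "g t < z" using covbyD(3)[OF c1[OF t(1)]] .
    ultimately show "g s \<le> z" "\<not> z \<le> g s" by auto
  qed
  \<comment> \<open>The upper tail turned upside down: the stem is \<open>f_{k-1}, ..., f_3\<close>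
    read downwards and the fork is \<open>f_k\<close>, \<open>z\<close>. The value at
    \<open>DA k\<close> is then overwritten by that of \<open>b\<close> or of
    \<open>c\<close>.\<close>
  let ?h = "\<lambda>s. case s of DA i \<Rightarrow> g (DF (k + 2 - i)) | DB \<Rightarrow> g (DF k) | _ \<Rightarrow> z"
  have emb: "dk_emb P k 2 (?h(DA k := g e))" if e: "e = DB \<or> e = DC" for e
  proof -
    \<comment> \<open>Away from \<open>DC\<close>, the new map is \<open>g\<close> after this
      reindexing; \<open>DC\<close> goes to \<open>z\<close>, which \<open>g\<close> need not reach,
      and is treated separately.\<close>
    let ?\<phi> = "\<lambda>s. case s of DA i \<Rightarrow> if i = k then e else DF (k + 2 - i) | _ \<Rightarrow> DF k"
    let ?f = "?h(DA k := g e)"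
    have f: "?f s = (if s = DC then z else g (?\<phi> s))" if "s \<in> dk_part k 2" for s
      using that by (cases s) auto
    have \<phi>: "?\<phi> s \<in> dk_part k k" if "s \<in> dk_part k 2" for s
      using that k e by (cases s) auto
    have \<phi>': "?\<phi> s \<in> dk_part k (k - 1)" if "s \<in> dk_part k 2" "s \<noteq> DB" "s \<noteq> DC" for s
      using that k e by (cases s) auto
    have \<phi>_ord: "dk_ord (?\<phi> s) (?\<phi> t) \<longleftrightarrow> dk_ord s t"
      if "s \<in> dk_part k 2" "t \<in> dk_part k 2" "s \<noteq> DC" "t \<noteq> DC" for s t
      using that k e by (cases s; cases t) auto
    \<comment> \<open>In this description the image is a union of two intervals with a common
      bottom, so its convexity is immediate.\<close>
    have img: "?f ` dk_part k 2 = {v \<in> P. g e \<le> v \<and> (v \<le> g (DF k) \<or> v \<le> z)}" (is "?L = ?R")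
    proof
      show "?L \<subseteq> ?R"
      proof
        fix v assume "v \<in> ?L"
        then obtain s where s: "s \<in> dk_part k 2" "v = ?f s" by blast
        have "g e \<le> z" using below(1)[of e] e by auto
        moreover have "dk_ord e (?\<phi> s)" "dk_ord (?\<phi> s) (DF k)"
          using s(1) e k by (cases s; auto)+
        moreover have "e \<in> dk_part k k" "DF k \<in> dk_part k k" using e k by auto
        ultimately show "v \<in> ?R"
          using s f[OF s(1)] z(1) \<phi>[OF s(1)] dk_emb_in[OF g] dk_emb_le_iff[OF g] by auto
      qed
      have A: "v \<in> ?L" if v: "v \<in> P" "g e \<le> v" "v \<le> g (DF k)" for v
      proof -
        have "e \<in> dk_part k k" "DF k \<in> dk_part k k" using e k by auto
        then obtain r where r: "r \<in> dk_part k k" "v = g r" "dk_ord e r"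
          using dk_emb_between[OF g _ _ v] by blast
        define s where "s = (case r of DF i \<Rightarrow> if i = k then DB else DA (k + 2 - i) | _ \<Rightarrow> DA k)"
        have s: "s \<in> dk_part k 2" "s \<noteq> DC" "?\<phi> s = r"
          using r e k unfolding s_def by (cases r; auto)+
        then have "v = ?f s" using f[OF s(1)] r(2) by simp
        then show ?thesis using s(1) by (rule image_eqI)
      qed
      show "?R \<subseteq> ?L"
      proof
        fix v assume v: "v \<in> ?R"
        consider "v = z" | "v < z" | "v \<le> g (DF k)" using v by force
        then show "v \<in> ?L"
        proof cases
          case 1
          then have "v = ?f DC" by simp
          then show ?thesis using dk_part_simps(3) by (rule image_eqI)
        next
          case 2
          \<comment> \<open>Every lower cover of \<open>z\<close> is a top of the
            \<open>d_k^-\<close>-set and hence also lies below \<open>f_k\<close>, which reduces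
            this case to \<open>A\<close>.\<close>
          then obtain y where y: "covby P y z" "v \<le> y"
            using locally_finite_cover_below[OF lf _ z(1)] v by blast
          then obtain t where t: "t \<in> dk_tops (k - 1)" "y = g t" using z(2) by blast
          then have "y < g (DF k)" using covbyD(3)[OF c2] by blast
          then show ?thesis using A v y by force
        next
          case 3
          then show ?thesis using A v by blast
        qed
      qed
    qed
    have "convex_in P (?f ` dk_part k 2)"
      unfolding img convex_in_def by (auto simp: itv_iff intro: order.trans)
    moreover have "?f s \<le> ?f t \<longleftrightarrow> dk_ord s t" if st: "s \<in> dk_part k 2" "t \<in> dk_part k 2" for s t
    proof -
      have DBC: "dk_ord DC t \<longleftrightarrow> t = DC" "dk_ord s DC \<longleftrightarrow> s = DC \<or> s \<noteq> DB"
        using st by (cases t; auto; fail | cases s; auto; fail)+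
      show ?thesis
      proof (cases "s = DC \<or> t = DC")
        case True
        have "z \<le> ?f t \<longleftrightarrow> t = DC"
          using f[OF st(2)] below(2)[OF \<phi>'[OF st(2)]] inc by (cases "t = DB") auto
        moreover have "?f s \<le> z \<longleftrightarrow> s = DC \<or> s \<noteq> DB"
          using f[OF st(1)] below(1)[OF \<phi>'[OF st(1)]] inc by (cases "s = DB") auto
        ultimately show ?thesis using True DBC by auto
      next
        case False
        then show ?thesis
          using f[OF st(1)] f[OF st(2)] \<phi>_ord[OF st] dk_emb_le_iff[OF g \<phi>[OF st(1)] \<phi>[OF st(2)]]
          by simp
      qed
    qed
    ultimately show ?thesis unfolding dk_emb_def by blast
  qed
  have "g DB = g DC" using stem_end_unique[OF k emb emb] by simp
  then show False using dk_emb_eq_iff[OF g, of DB DC] by simp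
qed

text \<open>The witness of \<open>d_k\<close>-completeness for the truncated interval coincides with
  \<open>g (DF k)\<close> by \<open>top_unique\<close>, so the maximum of an arbitrary
  \<open>d_k\<close>-interval inherits both properties of the witness.\<close>

lemma covers_top:
  assumes k: "3 \<le> k" and g: "dk_emb P k k g"
  shows "{y. covby P y (g (DF k))} = g ` dk_tops (k - 1)"
    and "\<And>S'. dk_minus_set P k S' \<Longrightarrow> S' \<noteq> g ` dk_part k (k - 1) \<Longrightarrow>
      \<not> (\<forall>m\<in>maximals S'. covby P m (g (DF k)))"
proof -
  have "dk_emb P k (k - 1) g" using dk_emb_subset[OF g] by simp
  then obtain z where z: "z \<in> P" "{y. covby P y z} = g ` dk_tops (k - 1)"
    "\<And>S'. dk_minus_set P k S' \<Longrightarrow> S' \<noteq> g ` dk_part k (k - 1) \<Longrightarrow>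
      \<not> (\<forall>m\<in>maximals S'. covby P m z)"
    using d_complete_witness[OF dc k] by blast
  with top_unique[OF k g z(1,2)]
  show "{y. covby P y (g (DF k))} = g ` dk_tops (k - 1)"
    "\<And>S'. dk_minus_set P k S' \<Longrightarrow> S' \<noteq> g ` dk_part k (k - 1) \<Longrightarrow>
      \<not> (\<forall>m\<in>maximals S'. covby P m (g (DF k)))"
    by auto
qed

text \<open>Written as an update at \<open>DA 3\<close> of a map that does not depend on
  \<open>w\<close>, to fit \<open>stem_end_unique\<close> with k = 3.\<close>

lemma vee_emb:
  assumes "x \<noteq> y" "covby P w x" "covby P w y"
  shows "dk_emb P 3 2 ((\<lambda>s. if s = DB then x else y)(DA 3 := w))" (is "dk_emb P 3 2 ?f")
proof -
  have part: "dk_part 3 2 = {DA 3, DB, DC}" by (auto simp: dk_part_def)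
  have "\<not> x \<le> y" "\<not> y \<le> x" "w < x" "w < y" "w \<in> P" "x \<in> P" "y \<in> P"
    using assms covby_incomparable covbyD by metis+
  moreover from this have "convex_in P {w, x, y}"
    using covbyD(4)[OF assms(2)] covbyD(4)[OF assms(3)]
    by (auto simp: convex_in_def itv_iff dest: order.trans less_imp_le) metis+
  moreover have "?f ` {DA 3, DB, DC} = {w, x, y}" by auto
  ultimately show ?thesis unfolding dk_emb_def part by (simp add: less_le_not_le)
qed

lemma vee_bottom_unique:
  assumes "x \<noteq> y" "covby P w x" "covby P w y" "covby P w' x" "covby P w' y"
  shows "w = w'"
  using stem_end_unique[of 3] vee_emb assms by blast

text \<open>If \<open>z\<close> and \<open>z'\<close> differed, then \<open>x\<close> and
  \<open>y\<close> would be two bottoms of vees with the same arms \<open>z\<close>,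
  \<open>z'\<close>.\<close>

lemma vee_top_unique:
  assumes "x \<noteq> y" "covby P x z" "covby P y z" "covby P x z'" "covby P y z'"
  shows "z = z'"
  using vee_bottom_unique[of z z' x y] assms by blast

lemma vee_has_top:
  assumes "x \<noteq> y" "covby P w x" "covby P w y"
  obtains z where "z \<in> P" "{v. covby P v z} = {x, y}"
proof -
  have "dk_emb P 3 (3 - 1) ((\<lambda>s. if s = DB then x else y)(DA 3 := w))"
    using vee_emb[OF assms] by simp
  then show thesis
    by (rule d_complete_witness[OF dc order_refl]) (rule that, auto simp: dk_tops_def)
qed

section \<open>Vees, diamonds and upper covers\<close>

lemma VT: "VT P"
  unfolding VT_def
proof (intro allI impI)
  fix w x y assume "x \<noteq> y \<and> covby P w x \<and> covby P w y"
  then obtain z where "{v. covby P v z} = {x, y}" using vee_has_top by blast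
  then show "\<exists>z. covby P x z \<and> covby P y z" by blast
qed

lemma UT: "UT P"
  unfolding UT_def vee_def vee_top_def using VT vee_top_unique unfolding VT_def by metis

lemma NCC: "NCC P"
  unfolding NCC_def overlap_def using vee_bottom_unique by auto

text \<open>By uniqueness of tops, \<open>z\<close> is the element supplied by
  \<open>d_3\<close>-completeness, whose lower covers are prescribed.\<close>

lemma covers_diamond_top:
  assumes "diamond P w x y z"
  shows "{v. covby P v z} = {x, y}"
proof -
  have d: "x \<noteq> y" "covby P w x" "covby P w y" "covby P x z" "covby P y z"
    using assms by (auto simp: diamond_def vee_def vee_top_def)
  then obtain z' where z': "{v. covby P v z'} = {x, y}" using vee_has_top by blast
  then show ?thesis using vee_top_unique[of x y z z'] d by blast
qed

lemma FT: "FT P"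
  unfolding FT_def using covers_diamond_top by blast

lemma DAI: "DAI P"
  unfolding DAI_def
proof (intro allI impI)
  fix w x y z assume d: "diamond P w x y z"
  then have c: "covby P w x" "covby P w y" "covby P x z" "covby P y z"
    by (auto simp: diamond_def vee_def vee_top_def)
  have "v \<in> {w, x, y, z}" if "v \<in> itv P w z" for v
  proof (cases "v = z")
    case False
    then have "v \<in> P" "z \<in> P" "v < z" using that covbyD(2)[OF c(3)] by (auto simp: itv_iff)
    then obtain u where u: "covby P u z" "v \<le> u"
      using locally_finite_cover_below[OF lf] by blast
    then have "u \<in> {x, y}" using covers_diamond_top[OF d] by blast
    then show ?thesis using covbyD(4)[OF c(1)] covbyD(4)[OF c(2)] that u(2) by (auto simp: itv_iff)
  qed simp
  moreover have "v \<in> itv P w z" if "v \<in> {w, x, y, z}" for v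
    using that covbyD(1-3)[OF c(1)] covbyD(1-3)[OF c(2)] covbyD(1-3)[OF c(3)] covbyD(1-3)[OF c(4)]
    by (auto simp: itv_iff)
  ultimately show "{w, x, y, z} = itv P w z" by blast
qed

text \<open>(VT) moves the cover of \<open>w\<close> by \<open>x\<close> one step up towards
  \<open>y\<close>: some \<open>x'\<close> above \<open>x\<close> covers the next element
  \<open>w'\<close>, and the interval from \<open>w'\<close> to \<open>y\<close> is smaller. As
  \<open>x \<le> x'\<close>, still \<open>x'\<close> is not below \<open>y\<close>.\<close>

lemma upper_cover_above:
  assumes "covby P w x" "w \<le> y" "y \<in> P" "\<not> x \<le> y"
  shows "\<exists>z. covby P y z \<and> x \<le> z"
  using assms
proof (induction "card (itv P w y)" arbitrary: w x rule: less_induct)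
  case less
  show ?case
  proof (cases "w = y")
    case False
    have w: "w \<in> P" using less.prems covbyD by blast
    obtain w' where w': "covby P w w'" "w' \<le> y"
      using locally_finite_cover_above[OF lf w] less.prems False by (metis order.not_eq_order_implies_strict)
    then have "x \<noteq> w'" using less.prems by blast
    then obtain x' where x': "covby P x x'" "covby P w' x'"
      using VT less.prems(1) w'(1) unfolding VT_def by blast
    have "itv P w' y \<subseteq> itv P w y" "w \<in> itv P w y" "w \<notin> itv P w' y"
      using covbyD(1-3)[OF w'(1)] less.prems(2) by (auto simp: itv_iff)
    then have "itv P w' y \<subset> itv P w y" by blast
    moreover have "finite (itv P w y)" using lf w less.prems(3) by (simp add: locally_finite_def)
    ultimately have "card (itv P w' y) < card (itv P w y)" by (rule psubset_card_mono[rotated])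
    moreover have "x \<le> x'" using covbyD(3)[OF x'(1)] by simp
    ultimately show ?thesis using less.hyps[OF _ x'(2) w'(2)] less.prems by (meson order.trans)
  qed (use less.prems in auto)
qed

lemma UPUE: "UPUE P"
  unfolding UPUE_def using upper_cover_above by blast

section \<open>Maxima of \<open>d_k\<close>-intervals and completing elements\<close>

lemma DkMF:
  assumes k: "3 \<le> k"
  shows "DkMF P k"
  unfolding DkMF_def
proof (intro allI impI)
  fix I z v assume I: "dk_interval P k I \<and> is_maximum I z" and v: "covby P v z"
  then obtain g where g: "dk_emb P k k g" "I = g ` dk_part k k" using dk_interval_iff[OF k] by blast
  then have "z = g (DF k)" using I dk_emb_is_maximum[OF g(1) k] by simp
  then have "v \<in> g ` dk_tops (k - 1)" using covers_top(1)[OF k g(1)] v by blast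
  moreover have "dk_tops (k - 1) \<subseteq> dk_part k k"
    using dk_tops_subset[of "k - 1" k] dk_part_mono[of k k "k - 1" k] k by force
  ultimately show "v \<in> I" using g(2) by blast
qed

text \<open>A common maximum covers the maximal elements of both truncated intervals, so
  \<open>covers_top\<close> forces these to be equal.\<close>

lemma DkMD:
  assumes k: "3 \<le> k"
  shows "DkMD P k"
  unfolding DkMD_def
proof (intro allI impI notI)
  fix I J z z'
  assume "dk_interval P k I \<and> dk_interval P k J \<and> I \<noteq> J \<and> is_maximum I z \<and> is_maximum J z'"
    and eq: "z = z'"
  then obtain g h where g: "dk_emb P k k g" "I = g ` dk_part k k"
    and h: "dk_emb P k k h" "J = h ` dk_part k k"
    and ne: "I \<noteq> J" and z: "is_maximum I z" "is_maximum J z'"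
    using dk_interval_iff[OF k] by metis
  have top: "z = g (DF k)" "z' = h (DF k)"
    using dk_emb_is_maximum[OF g(1) k] dk_emb_is_maximum[OF h(1) k] z g h by auto
  have h': "dk_emb P k (k - 1) h" using dk_emb_subset[OF h(1)] by simp
  then have "dk_minus_set P k (h ` dk_part k (k - 1))" using dk_minus_set_iff[OF k] by blast
  moreover have "\<forall>m\<in>maximals (h ` dk_part k (k - 1)). covby P m (g (DF k))"
    using dk_emb_maximals[OF h'] covers_top(1)[OF k h(1)] top eq k by auto
  ultimately have "h ` dk_part k (k - 1) = g ` dk_part k (k - 1)"
    using covers_top(2)[OF k g(1)] by blast
  then have "I = J"
    using dk_emb_image_remove_top(1)[OF g(1) k] dk_emb_image_remove_top(1)[OF h(1) k] g h top eq by simp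
  then show False using ne by simp
qed

lemma completing_element_exists:
  assumes k: "3 \<le> k" and S: "dk_minus_set P k S"
  obtains z where "completing_element P k S z" "z \<in> P" "{y. covby P y z} = maximals S"
proof -
  obtain g where g: "dk_emb P k (k - 1) g" "S = g ` dk_part k (k - 1)"
    using S dk_minus_set_iff[OF k] by blast
  obtain z where z: "z \<in> P" "{y. covby P y z} = g ` dk_tops (k - 1)"
    by (rule d_complete_witness[OF dc k g(1)])
  let ?h = "g(DF k := z)"
  have k1: "2 \<le> k - 1" "Suc (k - 1) = k" using k by auto
  have h: "dk_emb P k k ?h" using dk_emb_extend_top[OF lf g(1) k1(1) z] k1(2) by simp
  have "DF k \<notin> dk_part k (k - 1)" using k by auto
  then have "?h ` dk_part k (k - 1) = S" using g(2) by auto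
  then have img: "?h ` dk_part k k = insert z S" using dk_emb_image_remove_top(1)[OF h k] by simp
  then have "dk_interval P k (insert z S)" using dk_interval_iff[OF k] h by metis
  moreover have "is_maximum (insert z S) z" using dk_emb_is_maximum[OF h k, of z] img by simp
  moreover have "{y. covby P y z} = maximals S" using dk_emb_maximals[OF g(1) k1(1)] z(2) g(2) by simp
  ultimately show thesis using that z(1) by (simp add: completing_element_def)
qed

lemma DkmCF:
  assumes k: "3 \<le> k"
  shows "DkmCF P k"
  unfolding DkmCF_def
proof (intro allI impI)
  fix S assume S: "dk_minus_set P k S"
  obtain z where z: "completing_element P k S z" "{y. covby P y z} = maximals S"
    using completing_element_exists[OF k S] by blast
  have "maximals S \<subseteq> S" by (auto simp: maximals_def)
  then show "\<exists>z. dk_interval P k (S \<union> {z}) \<and> is_maximum (S \<union> {z}) z \<and>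
      (\<forall>v. covby P v z \<longrightarrow> v \<in> S)"
    using z by (intro exI[of _ z]) (auto simp: completing_element_def)
qed

lemma DkmC: "3 \<le> k \<Longrightarrow> DkmC P k"
  using DkmCF unfolding DkmCF_def DkmC_def by meson

lemma UCk:
  assumes k: "3 \<le> k"
  shows "UCk P k"
  unfolding UCk_def
proof (intro allI impI)
  fix S assume S: "dk_minus_set P k S"
  obtain z where z: "completing_element P k S z" "z \<in> P" "{y. covby P y z} = maximals S"
    using completing_element_exists[OF k S] by blast
  have "z = z'" if z': "completing_element P k S z'" for z'
  proof -
    obtain g where g: "dk_emb P k k g" "insert z' S = g ` dk_part k k"
      using z' dk_interval_iff[OF k] unfolding completing_element_def by blast
    have top: "z' = g (DF k)"
      using z' dk_emb_is_maximum[OF g(1) k] g(2) unfolding completing_element_def by simp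
    \<comment> \<open>By cardinality: otherwise \<open>S\<close> itself would be a copy of
      \<open>d_k(1)\<close>, but it has at most as many elements as
      \<open>dk_part k (k - 1)\<close>.\<close>
    have "z' \<notin> S"
    proof
      assume "z' \<in> S"
      then have "card S = card (g ` dk_part k k)" using g(2) by (simp add: insert_absorb)
      also have "\<dots> = card (dk_part k k)"
        using dk_emb_eq_iff[OF g(1)] by (intro card_image inj_onI) blast
      also have "\<dots> > card (dk_part k (k - 1))"
      proof (rule psubset_card_mono)
        show "finite (dk_part k k)" by (simp add: dk_part_def)
        have "DF k \<in> dk_part k k" "DF k \<notin> dk_part k (k - 1)" using k by auto
        moreover have "dk_part k (k - 1) \<subseteq> dk_part k k" by (rule dk_part_mono) simp_all
        ultimately show "dk_part k (k - 1) \<subset> dk_part k k" by blast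
      qed
      finally have "card (dk_part k (k - 1)) < card S" .
      moreover obtain f where "S = f ` dk_part k (k - 1)" using S dk_minus_set_iff[OF k] by blast
      ultimately show False using card_image_le[of "dk_part k (k - 1)" f] by (simp add: dk_part_def)
    qed
    then have "S = g ` dk_part k (k - 1)"
      using dk_emb_image_remove_top[OF g(1) k] g(2) top by (metis insert_ident)
    moreover have "dk_emb P k (k - 1) g" using dk_emb_subset[OF g(1)] by simp
    ultimately have "{y. covby P y z} = g ` dk_tops (k - 1)"
      using z(3) dk_emb_maximals[of P k "k - 1" g] k by simp
    then show ?thesis using top_unique[OF k g(1) z(2)] top by simp
  qed
  then show "\<exists>!z. completing_element P k S z" using z(1) by blast
qed

text \<open>For k \<ge> 4, overlapping sets are different intervals with the same maximum, so the
  witness for one covers the only maximal element of the other.\<close>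

lemma NODkm:
  assumes k: "3 \<le> k"
  shows "NODkm P k"
proof (cases "k = 3")
  case True
  then show ?thesis using NCC by (simp add: NODkm_def NCC_def)
next
  case False
  show ?thesis
    unfolding NODkm_def
  proof clarify
    fix S S' assume "overlap P k S S'"
    then obtain w w' u z where o: "z \<in> P" "S = itv P w z" "S' = itv P w' z"
      "dk_minus_interval P k S" "dk_minus_interval P k S'"
      "{v \<in> S. covby P w v} = {u}" "w' \<noteq> w" "covby P w' u"
      using False by (auto simp: overlap_def)
    have S: "dk_minus_set P k S" "dk_minus_set P k S'" using o by (auto simp: dk_minus_interval_def)
    have u: "covby P w u" "u \<in> S" using o(6) by auto
    then have le: "w \<le> z" "w' \<le> z" "w \<in> P" "w' \<in> P"
      using o(1,2) covbyD(1-3)[OF u(1)] covbyD(1-3)[OF o(8)] by (auto simp: itv_iff)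
    have max: "maximals (itv P v z) = {z}" if v: "v \<le> z" for v
    proof -
      have "s \<in> maximals (itv P v z) \<longleftrightarrow> s = z" for s
        unfolding maximals_def mem_Collect_eq itv_iff Bex_def using v o(1)
        by (metis less_le_not_le order.not_eq_order_implies_strict order_refl)
      then show ?thesis by blast
    qed
    have "w \<in> itv P w z" "w' \<in> itv P w' z" using le by (auto simp: itv_iff)
    then have "S \<noteq> S'" using o(2,3,7) by (metis antisym itv_iff)
    moreover obtain z' where "{y. covby P y z'} = maximals S"
      "\<forall>T. dk_minus_set P k T \<and> T \<noteq> S \<longrightarrow> \<not> (\<forall>m\<in>maximals T. covby P m z')"
      using dc S(1) k unfolding d_complete_def dk_complete_def by metis
    ultimately show False using S(2) max le(1,2) o(2,3) by blast
  qed
qed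

section \<open>\<open>Y\<^sub>k\<close>-sets and \<open>\<Lambda>Y\<^sub>k\<close>-sets\<close>

text \<open>The isomorphism in \<open>Yk_set\<close> is arbitrary; order alone forces it to match
  \<open>w\<close> with \<open>a_k\<close> and \<open>x\<close>, \<open>y\<close> with
  \<open>b\<close>, \<open>c\<close>.\<close>

lemma Yk_set_emb:
  assumes k: "3 \<le> k" and Y: "Yk_set P k w x y"
  obtains g where "dk_emb P k 2 g" "itv2 P w x y = g ` dk_part k 2"
    "g (DA k) = w" "{g DB, g DC} = {x, y}"
proof -
  have "DA ` {3..k} \<union> {DB, DC} = dk_part k 2" by (auto simp: dk_part_def)
  moreover have "dk_part k 2 \<subseteq> dk_carrier k"
    unfolding dk_carrier_eq using k by (intro dk_part_mono) auto
  ultimately obtain g where g: "dk_emb P k 2 g" "itv2 P w x y = g ` dk_part k 2"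
    using Y iso_dk_part_iff unfolding Yk_set_def dk_emb_def by metis
  have wxy: "w \<in> P" "x \<in> P" "y \<in> P" using Y by (auto simp: Yk_set_def)
  have below_top: "v \<le> x \<or> v \<le> y" and above_w: "w \<le> v" if "v \<in> g ` dk_part k 2" for v
    using that g(2) by (auto simp: itv2_def itv_iff)
  have bc: "g DB \<in> g ` dk_part k 2" "g DC \<in> g ` dk_part k 2" by simp_all
  have "w \<le> x \<or> w \<le> y" using below_top above_w bc(1) order.trans by blast
  then have "w \<in> g ` dk_part k 2"
    unfolding g(2)[symmetric] using wxy by (auto simp: itv2_def itv_iff)
  then obtain s where s: "s \<in> dk_part k 2" "w = g s" by blast
  have ak: "DA k \<in> dk_part k 2" using k by simp
  have "dk_ord s (DA k)" using above_w s ak dk_emb_le_iff[OF g(1)] by blast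
  moreover have "dk_ord (DA k) s" using s(1) by (cases s) auto
  ultimately have "g (DA k) = w" using s(2) dk_ord_antisym by blast
  have top: "e = s" if e: "e = DB \<or> e = DC" and s: "s \<in> dk_part k 2" "g e \<le> g s" for e s
    using that dk_emb_le_iff[OF g(1)] by (cases s) auto
  \<comment> \<open>\<open>g e\<close> is maximal in the set and lies below \<open>x\<close> or
    \<open>y\<close>; the one above it is then itself in the set, hence equal to it.\<close>
  have eq: "g e \<in> {x, y}" if e: "e = DB \<or> e = DC" for e
  proof -
    have ge: "g e \<in> g ` dk_part k 2" using e by auto
    obtain v where v: "v \<in> {x, y}" "g e \<le> v" using below_top[OF ge] by blast
    then have "w \<le> v" using above_w[OF ge] by (blast intro: order.trans)
    then have "v \<in> g ` dk_part k 2"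
      unfolding g(2)[symmetric] using v(1) wxy by (auto simp: itv2_def itv_iff)
    then show ?thesis using top[OF e] v by blast
  qed
  have "g DB \<noteq> g DC" using dk_emb_eq_iff[OF g(1), of DB DC] by simp
  then have "{g DB, g DC} = {x, y}" using eq[of DB] eq[of DC] by auto
  then show thesis using that g \<open>g (DA k) = w\<close> by blast
qed

lemma stem_covby:
  assumes "dk_emb P k 2 g" "3 \<le> j" "Suc j \<le> k"
  shows "covby P (g (DA (Suc j))) (g (DA j))"
proof (rule dk_emb_covby[OF assms(1)])
  show "r = DA (Suc j) \<or> r = DA j" if "dk_ord (DA (Suc j)) r" "dk_ord r (DA j)" for r
    using that by (cases r) auto
qed (use assms in auto)

lemma fork_covby:
  assumes "dk_emb P k 2 g" "3 \<le> k" "e = DB \<or> e = DC"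
  shows "covby P (g (DA 3)) (g e)"
proof (rule dk_emb_covby[OF assms(1)])
  show "r = DA 3 \<or> r = e" if "r \<in> dk_part k 2" "dk_ord (DA 3) r" "dk_ord r e" for r
    using that assms(3) by (cases r) auto
qed (use assms in auto)

text \<open>Adjoining \<open>u\<close> or \<open>v\<close> to the stem gives two embeddings of
  \<open>dk_part (Suc k) 2\<close> that differ only at the bottom, against
  \<open>stem_end_unique\<close>.\<close>

lemma NLambdaYk:
  assumes k: "3 \<le> k"
  shows "NLambdaYk P k"
  unfolding NLambdaYk_def
proof clarify
  fix u v x y assume "LambdaYk_set P k u v x y"
  then obtain w where uv: "u \<noteq> v" "covby P u w" "covby P v w" and Y: "Yk_set P k w x y"
    and convex: "convex_in P ({u, v} \<union> itv2 P w x y)"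
    unfolding LambdaYk_set_def by metis
  obtain g where g: "dk_emb P k 2 g" "itv2 P w x y = g ` dk_part k 2" "g (DA k) = w"
    using Yk_set_emb[OF k Y] by blast
  have above: "w \<le> s" if "s \<in> itv2 P w x y" for s using that by (auto simp: itv2_def itv_iff)
  \<comment> \<open>Dropping \<open>q\<close> preserves convexity, as everything left lies above
    \<open>p\<close> while \<open>q\<close>, having the common upper cover \<open>w\<close>, does
    not.\<close>
  have "convex_in P (insert p (itv2 P w x y))"
    if p: "{p, q} = {u, v}" "covby P p w" "covby P q w" "p \<noteq> q" for p q
    unfolding convex_in_def
  proof (intro conjI ballI subsetI)
    have convex': "convex_in P ({p, q} \<union> itv2 P w x y)" using convex p(1) by simp
    show "a \<in> P" if "a \<in> insert p (itv2 P w x y)" for a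
      using that convex' by (auto simp: convex_in_def)
    fix a b t assume a: "a \<in> insert p (itv2 P w x y)" "b \<in> insert p (itv2 P w x y)" "t \<in> itv P a b"
    then have "t \<in> {p, q} \<union> itv2 P w x y" using convex' unfolding convex_in_def by blast
    moreover have "p \<le> a" using a(1) above covbyD(3)[OF p(2)] by fastforce
    then have "p \<le> t" using a(3) by (auto simp: itv_iff)
    then have "t \<noteq> q" using covby_incomparable_below[OF p(2,3,4)] by blast
    ultimately show "t \<in> insert p (itv2 P w x y)" by blast
  qed
  from this[of u v] this[of v u] have
    "dk_emb P (Suc k) 2 (g(DA (Suc k) := u))" "dk_emb P (Suc k) 2 (g(DA (Suc k) := v))"
    using uv g k by (auto intro!: dk_emb_extend_bottom)
  then show False using stem_end_unique[of "Suc k" g u v] k uv(1) by simp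
qed

end

section \<open>Finite posets\<close>

lemma chain_from_to_relpowp:
  assumes "chain_from_to P x y xs"
  shows "(covby P ^^ chain_length xs) x y"
proof -
  have "xs \<noteq> [] \<Longrightarrow> successively (covby P) xs \<Longrightarrow> (covby P ^^ (length xs - 1)) (hd xs) (last xs)"
    by (induction xs rule: induct_list012) (auto intro: relpowp_Suc_I2 simp del: relpowp.simps(2))
  then show ?thesis using assms by (auto simp: chain_from_to_def cover_chain_def chain_length_def)
qed

lemma rank_function_relpowp:
  assumes "rank_function P \<rho>" "(covby P ^^ n) x y"
  shows "\<rho> y = \<rho> x + int n"
  using assms(2)
proof (induction n arbitrary: y)
  case (Suc n)
  then obtain z where "(covby P ^^ n) x z" "covby P z y" by auto
  then show ?case using Suc.IH assms(1) by (simp add: rank_function_def)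
qed auto

locale finite_d_complete_poset = d_complete_poset +
  assumes fin: "finite P"
begin

text \<open>Induction from the top of a finite poset, measured by the number of strictly larger
  elements.\<close>

lemma up_induct [consumes 1, case_names step]:
  assumes "x \<in> P" and step: "\<And>x. x \<in> P \<Longrightarrow> (\<And>y. covby P x y \<Longrightarrow> Q y) \<Longrightarrow> Q x"
  shows "Q x"
  using assms(1)
proof (induction "card {v \<in> P. x < v}" arbitrary: x rule: less_induct)
  case less
  show ?case
  proof (rule step[OF less.prems])
    fix y assume y: "covby P x y"
    have "{v \<in> P. y < v} \<subseteq> {v \<in> P. x < v}" "y \<in> {v \<in> P. x < v}" "y \<notin> {v \<in> P. y < v}"
      using covbyD(1-3)[OF y] by auto
    then have "{v \<in> P. y < v} \<subset> {v \<in> P. x < v}" by blast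
    then have "card {v \<in> P. y < v} < card {v \<in> P. x < v}" using fin by (intro psubset_card_mono) auto
    then show "Q y" using less.hyps covbyD(2)[OF y] by blast
  qed
qed

lemma relpowp_covby_of_le:
  assumes "x \<in> P" "y \<in> P" "x \<le> y"
  shows "\<exists>n. (covby P ^^ n) x y"
  using assms
proof (induction x rule: up_induct)
  case (step x)
  show ?case
  proof (cases "x = y")
    case True
    then show ?thesis by (intro exI[of _ 0]) simp
  next
    case False
    then have "x < y" using step.prems by simp
    then obtain u where "covby P x u" "u \<le> y"
      using locally_finite_cover_above[OF lf step.hyps step.prems(1)] by blast
    then show ?thesis using step.IH step.prems(1) relpowp_Suc_I2 by metis
  qed
qed

section \<open>Paths to maximal elements and the rank function\<close>

lemma maximal_iff: "x \<in> maximals P \<longleftrightarrow> x \<in> P \<and> (\<forall>y. \<not> covby P x y)"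
proof -
  have "\<exists>u. covby P x u" if "x \<in> P" "y \<in> P" "x < y" for y
    using locally_finite_cover_above[OF lf that] by blast
  then show ?thesis using covbyD(2,3) unfolding maximals_def by blast
qed

lemma path_to_maximal:
  assumes "x \<in> P"
  shows "\<exists>m\<in>maximals P. \<exists>n. (covby P ^^ n) x m"
  using assms
proof (induction rule: up_induct)
  case (step x)
  show ?case
  proof (cases "x \<in> maximals P")
    case True
    then show ?thesis by (intro bexI[of _ x] exI[of _ 0]) auto
  next
    case False
    then obtain y where "covby P x y" using step.hyps maximal_iff by blast
    then show ?thesis using step.IH by (meson relpowp_Suc_I2)
  qed
qed

text \<open>A confluence argument: (VT) closes any two diverging first steps in one further step
  each, so neither the end nor the length of a path depends on the choices made.\<close>

lemma path_to_maximal_unique: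
  assumes "x \<in> P" "m \<in> maximals P" "m' \<in> maximals P" "(covby P ^^ n) x m" "(covby P ^^ n') x m'"
  shows "m = m' \<and> n = n'"
  using assms
proof (induction x arbitrary: m m' n n' rule: up_induct)
  case (step x)
  show ?case
  proof (cases "x \<in> maximals P")
    case True
    then have "n = 0" "n' = 0"
      using step.prems(3,4) maximal_iff by (metis relpowp_E2)+
    then show ?thesis using step.prems(3,4) by simp
  next
    case False
    then have "n \<noteq> 0" "n' \<noteq> 0" using step.prems by (metis relpowp_0_E)+
    then obtain a b where n: "n = Suc a" "n' = Suc b" by (meson not0_implies_Suc)
    obtain y where y: "covby P x y" "(covby P ^^ a) y m"
      using step.prems(3) n(1) by (metis relpowp_Suc_D2)
    obtain y' where y': "covby P x y'" "(covby P ^^ b) y' m'"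
      using step.prems(4) n(2) by (metis relpowp_Suc_D2)
    show ?thesis
    proof (cases "y = y'")
      case True
      then show ?thesis using step.IH[OF y(1)] step.prems y y' n by blast
    next
      case False
      \<comment> \<open>Continuing from \<open>z\<close> to some maximal \<open>m''\<close> gives
        paths of one length from \<open>y\<close> and from \<open>y'\<close>, to which the induction
        hypotheses compare the given ones.\<close>
      then obtain z where z: "covby P y z" "covby P y' z" using VT y(1) y'(1) unfolding VT_def by blast
      then obtain m'' c where m'': "m'' \<in> maximals P" "(covby P ^^ c) z m''"
        using path_to_maximal covbyD(2) by blast
      then have "(covby P ^^ Suc c) y m''" "(covby P ^^ Suc c) y' m''"
        using z relpowp_Suc_I2 by metis+
      then show ?thesis
        using step.IH[OF y(1) step.prems(1) m''(1) y(2)] step.IH[OF y'(1) step.prems(2) m''(1) y'(2)] n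
        by metis
    qed
  qed
qed

lemma ranked: "ranked P"
proof -
  have "\<forall>x\<in>P. \<exists>n. \<exists>m\<in>maximals P. (covby P ^^ n) x m" using path_to_maximal by blast
  then obtain h where h: "\<And>x. x \<in> P \<Longrightarrow> \<exists>m\<in>maximals P. (covby P ^^ h x) x m" by metis
  have "h x = Suc (h y)" if xy: "covby P x y" for x y
  proof -
    have P: "x \<in> P" "y \<in> P" using covbyD(1,2)[OF xy] by auto
    obtain m m' where m: "m \<in> maximals P" "(covby P ^^ h x) x m"
      "m' \<in> maximals P" "(covby P ^^ h y) y m'" using h P by blast
    then show ?thesis
      using path_to_maximal_unique[OF P(1) m(1,3,2) relpowp_Suc_I2[of "covby P", OF xy m(4)]] by simp
  qed
  \<comment> \<open>\<open>h\<close> is the distance to a maximal element and drops by one along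
    each cover, hence the sign.\<close>
  then have "rank_function P (\<lambda>x. - int (h x))" by (simp add: rank_function_def)
  then show ?thesis unfolding ranked_def by blast
qed

section \<open>Chain lengths, connectedness and short intervals\<close>

lemma chain_length_unique:
  assumes "chain_from_to P x y xs" "chain_from_to P x y ys"
  shows "chain_length xs = chain_length ys"
proof -
  obtain \<rho> where \<rho>: "rank_function P \<rho>" using ranked unfolding ranked_def by blast
  show ?thesis
    using rank_function_relpowp[OF \<rho> chain_from_to_relpowp[OF assms(1)]]
      rank_function_relpowp[OF \<rho> chain_from_to_relpowp[OF assms(2)]] by simp
qed

lemma CLE: "CLE P"
  unfolding CLE_def using chain_length_unique by blast

text \<open>The maximal element reached from \<open>x\<close> is unique and does not change along a
  cover, so it is constant on a connected Hasse diagram.\<close>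

lemma UM:
  assumes "hasse_connected P"
  shows "UM P"
proof -
  define top where "top x = (THE m. m \<in> maximals P \<and> (\<exists>n. (covby P ^^ n) x m))" for x
  have top: "top x = m" if "x \<in> P" "m \<in> maximals P" "(covby P ^^ n) x m" for x m n
    unfolding top_def using that path_to_maximal_unique by (intro the_equality) blast+
  have step: "top x = top y" if xy: "covby P x y" for x y
  proof -
    have P: "x \<in> P" "y \<in> P" using covbyD[OF xy] by auto
    obtain m n where m: "m \<in> maximals P" "(covby P ^^ n) y m" using path_to_maximal[OF P(2)] by blast
    then show ?thesis
      using top[OF P(2) m] top[OF P(1) m(1) relpowp_Suc_I2[of "covby P", OF xy m(2)]] by simp
  qed
  have eq: "top x = top y" if "equivclp (covby P) x y" for x y
    using that by (induction rule: equivclp_induct) (auto dest: step)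
  have self: "top m = m" if "m \<in> maximals P" for m
    using top[of m m 0] that by (simp add: maximals_def)
  obtain x where "x \<in> P" using assms by (auto simp: hasse_connected_def)
  then obtain m where m: "m \<in> maximals P" using path_to_maximal by blast
  have "m' = m" if m': "m' \<in> maximals P" for m'
  proof -
    have "equivclp (covby P) m' m"
      using assms m m' by (auto simp: hasse_connected_def maximals_def)
    then show ?thesis using eq self m m' by metis
  qed
  then show ?thesis unfolding UM_def using m by blast
qed

lemma CLMEE: "hasse_connected P \<Longrightarrow> CLMEE P"
  unfolding CLMEE_def using UM chain_length_unique by blast

lemma SS: "SS P"
  unfolding SS_def
proof (intro allI impI)
  fix w z assume "short_interval P w z"
  then obtain u where u: "covby P w u" "covby P u z" unfolding short_interval_def by blast
  obtain \<rho> where \<rho>: "rank_function P \<rho>" using ranked unfolding ranked_def by blast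
  show "card (itv P w z) \<in> {3, 4}"
  proof (cases "\<exists>v. v \<noteq> u \<and> covby P w v \<and> covby P v z")
    case True
    then obtain v where "v \<noteq> u" "covby P w v" "covby P v z" by blast
    then have "diamond P w u v z" using u by (auto simp: diamond_def vee_def vee_top_def)
    then have "{w, u, v, z} = itv P w z" using DAI unfolding DAI_def by blast
    moreover have "w \<noteq> u" "w \<noteq> v" "w \<noteq> z" "u \<noteq> z" "v \<noteq> z"
      using covbyD(3) u \<open>covby P w v\<close> \<open>covby P v z\<close> order.strict_trans by blast+
    then have "card {w, u, v, z} = 4" using \<open>v \<noteq> u\<close> by auto
    ultimately show ?thesis by simp
  next
    case False
    \<comment> \<open>A further \<open>v\<close> lies between a cover \<open>p\<close> of
      \<open>w\<close> and a lower cover \<open>q\<close> of \<open>z\<close>. These have equal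
      rank, so \<open>p = v = q\<close>, a second midpoint, which this case excludes.\<close>
    have "v \<in> {w, u, z}" if v: "v \<in> itv P w z" for v
    proof (rule ccontr)
      assume "v \<notin> {w, u, z}"
      then have P: "v \<in> P" "w < v" "v < z" "w \<in> P" "z \<in> P" "v \<noteq> u"
        using v u covbyD(1,2) by (auto simp: itv_iff)
      obtain p where p: "covby P w p" "p \<le> v"
        using locally_finite_cover_above[OF lf P(4,1,2)] by blast
      obtain q where q: "covby P q z" "v \<le> q"
        using locally_finite_cover_below[OF lf P(1,5,3)] by blast
      have "\<rho> p = \<rho> q" using \<rho> u p(1) q(1) unfolding rank_function_def by (metis add_right_cancel)
      have "p = q"
      proof (rule ccontr)
        assume "p \<noteq> q"
        then have "p < q" using p(2) q(2) by auto
        then obtain r where r: "covby P p r" "r \<le> q"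
          using locally_finite_cover_above[OF lf] covbyD(1,2) p(1) q(1) by metis
        then obtain n where "(covby P ^^ n) r q" using relpowp_covby_of_le covbyD(1,2) q(1) by metis
        then have "\<rho> q = \<rho> p + 1 + int n"
          using rank_function_relpowp[OF \<rho>] \<rho> r(1) unfolding rank_function_def by metis
        then show False using \<open>\<rho> p = \<rho> q\<close> by simp
      qed
      then have "v = p" using p(2) q(2) by auto
      then show False using False P(6) p(1) q(1) \<open>p = q\<close> by blast
    qed
    moreover have "w < u" "u < z" "w \<in> P" "u \<in> P" "z \<in> P" using u covbyD by blast+
    moreover from this have "v \<in> itv P w z" if "v \<in> {w, u, z}" for v
      using that by (auto simp: itv_iff)
    ultimately have "itv P w z = {w, u, z}" by blast
    moreover have "w \<noteq> u" "u \<noteq> z" "w \<noteq> z" using \<open>w < u\<close> \<open>u < z\<close> by auto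
    then have "card {w, u, z} = 3" by simp
    ultimately show ?thesis by simp
  qed
qed

text \<open>Three pairwise vees have three distinct tops, which are again pairwise vees.\<close>

lemma no_vee_triple:
  assumes "x \<in> P"
  shows "vee P p x y \<Longrightarrow> vee P q x z \<Longrightarrow> vee P r y z \<Longrightarrow> False"
  using assms
proof (induction x arbitrary: y z p q r rule: up_induct)
  case (step x)
  obtain a where a: "{v. covby P v a} = {x, y}" using vee_has_top step.prems(1) unfolding vee_def by metis
  obtain b where b: "{v. covby P v b} = {x, z}" using vee_has_top step.prems(2) unfolding vee_def by metis
  obtain c where c: "{v. covby P v c} = {y, z}" using vee_has_top step.prems(3) unfolding vee_def by metis
  have ne: "x \<noteq> y" "x \<noteq> z" "y \<noteq> z" using step.prems by (auto simp: vee_def)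
  \<comment> \<open>Different sets of lower covers make the tops distinct. The new vees have bottoms
    \<open>x\<close>, \<open>y\<close>, \<open>z\<close>, and \<open>a\<close> covers
    \<open>x\<close>, so the induction hypothesis applies at \<open>a\<close>.\<close>
  then have "a \<noteq> b" "a \<noteq> c" "b \<noteq> c" using a b c by (metis doubleton_eq_iff)+
  then have "vee P x a b" "vee P y a c" "vee P z b c" "covby P x a"
    using a b c unfolding vee_def by blast+
  then show False using step.IH by blast
qed

lemma NTC: "NTC P"
  unfolding NTC_def
proof clarify
  fix w x y z assume "x \<noteq> y" "x \<noteq> z" "y \<noteq> z" and c: "covby P w x" "covby P w y" "covby P w z"
  then have "vee P w x y" "vee P w x z" "vee P w y z" by (auto simp: vee_def)
  then show False using no_vee_triple covbyD(2)[OF c(1)] by blast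
qed

text \<open>Induction down the stem from the fork. At the fork a third cover contradicts (NTC);
  further down, (VT) gives a \<open>v'\<close> covering both \<open>v\<close> and the next stem
  element, \<open>v'\<close> is in the set by induction, and convexity brings in
  \<open>v\<close>.\<close>

lemma YECOI:
  assumes k: "3 \<le> k"
  shows "YECOI P k"
  unfolding YECOI_def
proof (intro allI impI ballI)
  fix w x y s v
  assume Y: "Yk_set P k w x y" and s: "s \<in> Yk_stem P w x y" and v: "covby P s v"
  obtain g where g: "dk_emb P k 2 g" "itv2 P w x y = g ` dk_part k 2" "{g DB, g DC} = {x, y}"
    using Yk_set_emb[OF k Y] by blast
  have in_set: "v \<in> g ` dk_part k 2" if "3 \<le> j" "j \<le> k" "covby P (g (DA j)) v" for j v
    using that
  proof (induction j arbitrary: v rule: dec_induct)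
    case base
    have "v = g DB \<or> v = g DC"
    proof (rule ccontr)
      assume "\<not> ?thesis"
      moreover have "g DB \<noteq> g DC" using dk_emb_eq_iff[OF g(1), of DB DC] by simp
      ultimately show False
        using NTC base fork_covby[OF g(1) k, of DB] fork_covby[OF g(1) k, of DC] unfolding NTC_def by metis
    qed
    then show ?case by auto
  next
    case (step j)
    have c: "covby P (g (DA (Suc j))) (g (DA j))" using stem_covby[OF g(1)] step by simp
    have mem: "DA j \<in> dk_part k 2" "DA (Suc j) \<in> dk_part k 2" using step by auto
    show ?case
    proof (cases "v = g (DA j)")
      case True
      then show ?thesis using mem(1) by blast
    next
      case False
      then obtain v' where v': "covby P v v'" "covby P (g (DA j)) v'"
        using VT c step.prems unfolding VT_def by blast
      then have "v' \<in> g ` dk_part k 2" using step by simp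
      moreover have "v \<in> itv P (g (DA (Suc j))) v'"
        using covbyD(3)[OF step.prems(2)] covbyD(1,3)[OF v'(1)] by (simp add: itv_iff less_imp_le)
      ultimately show ?thesis using g(1) mem(2) unfolding dk_emb_def convex_in_def by blast
    qed
  qed
  obtain t where t: "t \<in> dk_part k 2" "s = g t" "t \<noteq> DB" "t \<noteq> DC"
    using s g(2,3) unfolding Yk_stem_def by blast
  then obtain j where "t = DA j" "3 \<le> j" "j \<le> k" by (cases t) auto
  then show "v \<in> itv2 P w x y" using in_set v t(2) g(2) by simp
qed

end

theorem theorem10p2:
  fixes P :: "'a::order set"
  assumes "locally_finite P" and "d_complete P"
  shows
    "(VT P \<and> FT P \<and> NCC P \<and>
      (\<forall>k\<ge>3. DkmC P k \<and> DkMF P k \<and> DkmCF P k \<and> NODkm P k \<and> DkMD P k) \<and>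
      UPUE P \<and> DAI P \<and> UT P \<and> (\<forall>k\<ge>3. UCk P k))
     \<and>
     (finite P \<longrightarrow>
      (CLE P \<and> SS P \<and> NTC P \<and> ranked P \<and> (\<forall>k\<ge>3. YECOI P k \<and> NLambdaYk P k)) \<and>
      (hasse_connected P \<longrightarrow> UM P \<and> CLMEE P))"
proof -
  interpret d_complete_poset P using assms by unfold_locales
  have "(CLE P \<and> SS P \<and> NTC P \<and> ranked P \<and> (\<forall>k\<ge>3. YECOI P k \<and> NLambdaYk P k)) \<and>
      (hasse_connected P \<longrightarrow> UM P \<and> CLMEE P)" if "finite P"
  proof -
    interpret finite_d_complete_poset P using that by unfold_locales
    show ?thesis using CLE SS NTC ranked YECOI NLambdaYk UM CLMEE by blast
  qed
  then show ?thesis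
    using VT FT NCC DkmC DkMF DkmCF NODkm DkMD UPUE DAI UT UCk by blast
qed

end
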